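(* Fix universal constants $\gamma\in(0,1]$, $K\ge1$. Let $L$ be a positive integer and $d_0,d_1,\dots,d_L$ positive integers with $\max\{d_0,\dots,d_L\}\le K L^{1-\gamma}$. Let $X\in\mathbb{R}^{d_0\times n}$, $W^*\in\mathbb{R}^{d_L\times d_0}$, $Y=W^*X$, with $K^{-1}\le\|X\|_F\le K$ and $K^{-1}\le\|Y\|_F\le K$. Consider the linear network $f(x;W_1,\dots,W_L)=\alpha W_L\cdots W_1x$ with $W_i\in\mathbb{R}^{d_i\times d_{i-1}}$, the loss $\ell(W_1,\dots,W_L)=\frac12\|\alpha W_L\cdots W_1X-Y\|_F^2$, and gradient descent $W_i(t+1)=W_i(t)-\eta\frac{\partial\ell}{\partial W_i}(W_1(t),\dots,W_L(t))$ from an initialization in which all entries of all $W_i(0)$ are independent and each entry of $W_i(0)$ is distributed as $\mathcal N(0,\sigma_i^2)$, where $\sigma_i>0$ and $\alpha>0$ satisfy $$\alpha^2\prod_{i=1}^L(d_i\sigma_i^2)\le L^K\quad\text{and}\quad d_i\sigma_i^2\ge L^{-K}\ \ \forall i\in[L].$$ Then there exist constants $c>0$, $c'>0$ and $L_0$, depending only on $\gamma$ and $K$, such that whenever $L\ge L_0$ and $0<\eta\le e^{cL^\gamma}$, with probability at least $0.9$ over the random initialization, $0.4\|Y\|_F^2\le\ell(W_1(t),\dots,W_L(t))\le0.6\|Y\|_F^2$ for all integers $0\le t\le e^{c'L^\gamma}$.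
   Context: $\|\cdot\|_F$ is the Frobenius norm; $[L]=\{1,\dots,L\}$. Note $\mathbb{E}\|f(x;W_1(0),\dots,W_L(0))\|^2=\alpha^2\prod_i(d_i\sigma_i^2)\|x\|^2$. *)

theory Defs
  imports "HOL-Probability.Probability"
begin

text \<open>Matrices of varying sizes are represented as functions nat => nat => real;
  only the entries inside the stated dimensions are ever used.\<close>
type_synonym mat = "nat \<Rightarrow> nat \<Rightarrow> real"

definition mmul :: "nat \<Rightarrow> mat \<Rightarrow> mat \<Rightarrow> mat" where
  "mmul m A B = (\<lambda>i j. \<Sum>k<m. A i k * B k j)"

definition fro :: "nat \<Rightarrow> nat \<Rightarrow> mat \<Rightarrow> real" where
  "fro p q A = sqrt (\<Sum>a<p. \<Sum>b<q. (A a b)\<^sup>2)"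

fun prodW :: "(nat \<Rightarrow> nat) \<Rightarrow> (nat \<Rightarrow> mat) \<Rightarrow> nat \<Rightarrow> mat" where
  "prodW d W 0 = (\<lambda>i j. if i = j then 1 else 0)"
| "prodW d W (Suc k) = mmul (d k) (W (Suc k)) (prodW d W k)"

definition loss :: "real \<Rightarrow> (nat \<Rightarrow> nat) \<Rightarrow> nat \<Rightarrow> nat \<Rightarrow> mat \<Rightarrow> mat \<Rightarrow> (nat \<Rightarrow> mat) \<Rightarrow> real" where
  "loss \<alpha> d L n X Y W =
     1/2 * (fro (d L) n (\<lambda>a b. \<alpha> * mmul (d 0) (prodW d W L) X a b - Y a b))\<^sup>2"

definition grad :: "real \<Rightarrow> (nat \<Rightarrow> nat) \<Rightarrow> nat \<Rightarrow> nat \<Rightarrow> mat \<Rightarrow> mat \<Rightarrow> (nat \<Rightarrow> mat)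
                     \<Rightarrow> nat \<Rightarrow> nat \<Rightarrow> nat \<Rightarrow> real" where
  "grad \<alpha> d L n X Y W i a b =
     deriv (\<lambda>s. loss \<alpha> d L n X Y (W(i := (W i)(a := (W i a)(b := s))))) (W i a b)"

primrec gd :: "real \<Rightarrow> (nat \<Rightarrow> nat) \<Rightarrow> nat \<Rightarrow> nat \<Rightarrow> mat \<Rightarrow> mat \<Rightarrow> real
                 \<Rightarrow> (nat \<Rightarrow> mat) \<Rightarrow> nat \<Rightarrow> (nat \<Rightarrow> mat)" where
  "gd \<alpha> d L n X Y \<eta> W0 0 = W0"
| "gd \<alpha> d L n X Y \<eta> W0 (Suc t) =
     (\<lambda>i a b. if 1 \<le> i \<and> i \<le> L \<and> a < d i \<and> b < d (i - 1)
              then gd \<alpha> d L n X Y \<eta> W0 t i a b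
                   - \<eta> * grad \<alpha> d L n X Y (gd \<alpha> d L n X Y \<eta> W0 t) i a b
              else gd \<alpha> d L n X Y \<eta> W0 t i a b)"

definition widx :: "(nat \<Rightarrow> nat) \<Rightarrow> nat \<Rightarrow> (nat \<times> nat \<times> nat) set" where
  "widx d L = {(i, a, b). 1 \<le> i \<and> i \<le> L \<and> a < d i \<and> b < d (i - 1)}"

text \<open>Initialization law: all entries independent, entry of W_i ~ N(0, sigma_i^2)
  (normal_density takes the standard deviation).\<close>
definition init_measure :: "(nat \<Rightarrow> nat) \<Rightarrow> nat \<Rightarrow> (nat \<Rightarrow> real) \<Rightarrow> (nat \<times> nat \<times> nat \<Rightarrow> real) measure" where
  "init_measure d L \<sigma> =
     (\<Pi>\<^sub>M p\<in>widx d L. density lborel (\<lambda>x. ennreal (normal_density 0 (\<sigma> (fst p)) x)))"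

definition to_weights :: "(nat \<Rightarrow> nat) \<Rightarrow> nat \<Rightarrow> (nat \<times> nat \<times> nat \<Rightarrow> real) \<Rightarrow> (nat \<Rightarrow> mat)" where
  "to_weights d L \<omega> = (\<lambda>i a b. if (i, a, b) \<in> widx d L then \<omega> (i, a, b) else 0)"

end

theory Submission
  imports Defs "HOL-Real_Asymp.Real_Asymp"
begin

text \<open>
  The norm of a product of independent Gaussian layers is typically far below its root mean square:
  a layer of width \<open>d\<close> multiplies the expected norm of a fixed vector by at most
  \<open>sqrt d * \<sigma> * (1 - 1 / (25 * d))\<close>, so \<open>L\<close> layers of width at most \<open>K * L powr (1 - \<gamma>)\<close>
  lose a factor \<open>exp (- L powr \<gamma> / (25 * K))\<close>. By Markov's inequality, with probability
  \<open>0.9\<close> all partial products of consecutive layers obey the corresponding bounds up to a polynomial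
  factor. These bounds survive exponentially small perturbations of the layers. The gradient with
  respect to one layer contains the product of all the others, hence is exponentially small as long as
  the layers stay near the initialization; so they do stay near it for exponentially many steps, and all
  the while the output is negligible compared to \<open>Y\<close>, i.e. the loss is close to half of the squared norm of \<open>Y\<close>.
\<close>

text \<open>Root mean squares show no decay: a layer multiplies the expected squared norm of a fixed
  vector by exactly \<open>d * \<sigma>^2\<close>. The decay sits in the gap between the mean of a
  square root and the square root of the mean, so everything is done with first moments of norms.
  The reciprocal widths sum to at least \<open>L powr \<gamma> / K\<close>, and 1/25 of that sum is
  the exponent gained.

  Every segment of layers is controlled relative to its own product of per-layer factors, because
  both the perturbation argument and the gradient cut the network at a layer and multiply the bounds
  of the two remaining pieces. The cut layer is then missing from the product. The polynomial lower
  bound on \<open>d * \<sigma>^2\<close> restores it at polynomial cost, and also turns absolute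
  changes of a layer into relative ones.

  With \<open>u = exp (- (L powr \<gamma>) / (50 * K))\<close> the scaled bound for all layers is at
  most a power of \<open>L\<close> times \<open>u^2\<close>. The number of steps times the learning
  rate may use up \<open>1 / u\<close>; the remaining factor \<open>u\<close> beats all polynomial
  losses.\<close>

section \<open>Expected norm of a Gaussian vector\<close>

text \<open>The Taylor coefficients \<open>1/8\<close> and \<open>1/16\<close> would give a vacuous bound on the mean norm in dimensions
  1 and 2; the smaller ones here work in every dimension.\<close>

lemma sqrt_le_cubic:
  fixes u :: real
  assumes "0 \<le> u"
  shows "sqrt u \<le> 1 + (u - 1) / 2 - (u - 1)\<^sup>2 / 10 + (u - 1) ^ 3 / 50"
proof -
  define x p where "x = sqrt u" and "p = 1 + (u - 1) / 2 - (u - 1)\<^sup>2 / 10 + (u - 1) ^ 3 / 50"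
  have u: "u = x\<^sup>2" using assms by (simp add: x_def)
  \<comment> \<open>In the variable \<open>x = sqrt u\<close> the difference is a polynomial of
    degree 6. The cubic is tangent to the square root at \<open>u = 1\<close>, hence the double root
    \<open>x = 1\<close>; the quotient is an explicit sum of squares.\<close>
  have "0 \<le> (x - 1)\<^sup>2 * ((x\<^sup>2 + x - 4)\<^sup>2 + 2 * (x - 1)\<^sup>2 + 1)"
    by (intro mult_nonneg_nonneg add_nonneg_nonneg) auto
  also have "\<dots> = 50 * (p - x)"
    unfolding p_def u by (simp add: power2_eq_square power3_eq_cube field_simps)
  finally show ?thesis unfolding x_def[symmetric] p_def[symmetric] by simp
qed

lemma (in prob_space) normal_even_moment:
  assumes "0 < s" and D: "distributed M lborel Z (\<lambda>x. ennreal (normal_density 0 s x))"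
  shows "has_bochner_integral M (\<lambda>x. (Z x) ^ (2 * k)) (fact (2 * k) / ((2 / s\<^sup>2) ^ k * fact k))"
proof -
  have 1: "has_bochner_integral lborel (\<lambda>x. normal_density 0 s x * x ^ (2 * k))
     (fact (2 * k) / ((2 / s\<^sup>2) ^ k * fact k))"
    using normal_moment_even[OF assms(1), of 0 k] by simp
  have i: "integrable M (\<lambda>x. (Z x) ^ (2 * k))"
    using distributed_integrable[OF D, of "\<lambda>x. x ^ (2 * k)"] 1
    by (auto simp: has_bochner_integral_iff)
  show ?thesis
    using distributed_integral[OF D, of "\<lambda>x. x ^ (2 * k)"] 1 i
    by (auto simp: has_bochner_integral_iff)
qed

text \<open>These are the moments of a scaled chi-square variable, as many as a cubic majorant of
  the square root needs. When a coordinate is added, its square is independent of the sum of the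
  others, so the mixed terms of the binomial expansions factor.\<close>

lemma (in prob_space) sum_squares_normal_moments:
  fixes Z :: "'i \<Rightarrow> 'a \<Rightarrow> real"
  assumes "finite I" "indep_vars (\<lambda>_. borel) Z I" "0 < s"
    and "\<And>i. i \<in> I \<Longrightarrow> distributed M lborel (Z i) (\<lambda>x. ennreal (normal_density 0 s x))"
  defines "n \<equiv> real (card I)"
  shows "has_bochner_integral M (\<lambda>x. \<Sum>i\<in>I. (Z i x)\<^sup>2) (n * s ^ 2)"
    and "has_bochner_integral M (\<lambda>x. (\<Sum>i\<in>I. (Z i x)\<^sup>2) ^ 2) (n * (n + 2) * s ^ 4)"
    and "has_bochner_integral M (\<lambda>x. (\<Sum>i\<in>I. (Z i x)\<^sup>2) ^ 3) (n * (n + 2) * (n + 4) * s ^ 6)"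
proof -
  have "has_bochner_integral M (\<lambda>x. \<Sum>i\<in>I. (Z i x)\<^sup>2) (real (card I) * s ^ 2)
    \<and> has_bochner_integral M (\<lambda>x. (\<Sum>i\<in>I. (Z i x)\<^sup>2) ^ 2) (real (card I) * (real (card I) + 2) * s ^ 4)
    \<and> has_bochner_integral M (\<lambda>x. (\<Sum>i\<in>I. (Z i x)\<^sup>2) ^ 3)
        (real (card I) * (real (card I) + 2) * (real (card I) + 4) * s ^ 6)"
    using assms(1,2,4)
  proof (induction I rule: finite_induct)
    case empty
    show ?case by (simp add: has_bochner_integral_zero)
  next
    case (insert i I)
    define n where "n = real (card I)"
    define \<xi> where "\<xi> = (\<lambda>x. (Z i x)\<^sup>2)"
    define S where "S = (\<lambda>x. \<Sum>i\<in>I. (Z i x)\<^sup>2)"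
    have ind: "indep_var borel \<xi> borel S"
      unfolding \<xi>_def S_def
      using indep_vars_sum[OF insert(1,2), of "\<lambda>i x. (Z i x)\<^sup>2"]
        indep_vars_compose2[OF insert.prems(1), of "\<lambda>_ x. x\<^sup>2" "\<lambda>_. borel"] by simp
    have "indep_vars (\<lambda>_. borel) Z I"
      using indep_vars_subset[OF insert.prems(1)] by blast
    then have S: "has_bochner_integral M S (n * s ^ 2)"
      "has_bochner_integral M (\<lambda>x. S x ^ 2) (n * (n + 2) * s ^ 4)"
      "has_bochner_integral M (\<lambda>x. S x ^ 3) (n * (n + 2) * (n + 4) * s ^ 6)"
      using insert.IH insert.prems(2) by (auto simp: S_def n_def)
    have D: "distributed M lborel (Z i) (\<lambda>x. ennreal (normal_density 0 s x))"
      using insert.prems(2) by blast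
    have X: "has_bochner_integral M \<xi> (s ^ 2)"
      "has_bochner_integral M (\<lambda>x. \<xi> x ^ 2) (3 * s ^ 4)"
      "has_bochner_integral M (\<lambda>x. \<xi> x ^ 3) (15 * s ^ 6)"
      using normal_even_moment[OF assms(3) D, of 1] normal_even_moment[OF assms(3) D, of 2]
        normal_even_moment[OF assms(3) D, of 3] assms(3)
      by (simp_all add: \<xi>_def fact_numeral field_simps flip: power_mult power_add)
        (simp add: power2_eq_square)
    have prod: "has_bochner_integral M (\<lambda>x. f (\<xi> x) * g (S x)) (a * b)"
      if "has_bochner_integral M (\<lambda>x. f (\<xi> x)) a" "has_bochner_integral M (\<lambda>x. g (S x)) b"
        "f \<in> borel_measurable borel" "g \<in> borel_measurable borel" for f g :: "real \<Rightarrow> real" and a b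
    proof -
      have 1: "indep_var borel (\<lambda>x. f (\<xi> x)) borel (\<lambda>x. g (S x))"
        using indep_var_compose[OF ind that(3,4)] by (simp add: comp_def)
      show ?thesis
        using indep_var_lebesgue_integral[OF 1] indep_var_integrable[OF 1] that(1,2)
        by (auto simp: has_bochner_integral_iff)
    qed
    have P11: "has_bochner_integral M (\<lambda>x. \<xi> x * S x) (s ^ 2 * (n * s ^ 2))"
      by (rule prod[of "\<lambda>x. x" _ "\<lambda>x. x"]) (use X(1) S(1) in auto)
    have P21: "has_bochner_integral M (\<lambda>x. \<xi> x ^ 2 * S x) (3 * s ^ 4 * (n * s ^ 2))"
      by (rule prod[of "\<lambda>x. x ^ 2" _ "\<lambda>x. x"]) (use X(2) S(1) in auto)
    have P12: "has_bochner_integral M (\<lambda>x. \<xi> x * S x ^ 2) (s ^ 2 * (n * (n + 2) * s ^ 4))"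
      by (rule prod[of "\<lambda>x. x" _ "\<lambda>x. x ^ 2"]) (use X(1) S(2) in auto)
    have e: "(\<Sum>i\<in>insert i I. (Z i x)\<^sup>2) = \<xi> x + S x" for x
      using insert by (simp add: \<xi>_def S_def)
    have c: "real (card (insert i I)) = n + 1"
      using insert by (simp add: n_def)
    have 1: "has_bochner_integral M (\<lambda>x. \<xi> x + S x) ((n + 1) * s ^ 2)"
      using has_bochner_integral_add[OF X(1) S(1)] by (simp add: algebra_simps)
    have "has_bochner_integral M (\<lambda>x. \<xi> x ^ 2 + (2 * (\<xi> x * S x) + S x ^ 2))
      (3 * s ^ 4 + (2 * (s ^ 2 * (n * s ^ 2)) + n * (n + 2) * s ^ 4))"
      by (intro has_bochner_integral_add has_bochner_integral_mult_right P11 X S)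
    also have "(\<lambda>x. \<xi> x ^ 2 + (2 * (\<xi> x * S x) + S x ^ 2)) = (\<lambda>x. (\<xi> x + S x) ^ 2)"
      by (simp add: fun_eq_iff power2_eq_square algebra_simps)
    also have "3 * s ^ 4 + (2 * (s ^ 2 * (n * s ^ 2)) + n * (n + 2) * s ^ 4) = (n + 1) * (n + 1 + 2) * s ^ 4"
      by algebra
    finally have 2: "has_bochner_integral M (\<lambda>x. (\<xi> x + S x) ^ 2) ((n + 1) * (n + 1 + 2) * s ^ 4)" .
    have "has_bochner_integral M (\<lambda>x. \<xi> x ^ 3 + (3 * (\<xi> x ^ 2 * S x) + (3 * (\<xi> x * S x ^ 2) + S x ^ 3)))
      (15 * s ^ 6 + (3 * (3 * s ^ 4 * (n * s ^ 2)) + (3 * (s ^ 2 * (n * (n + 2) * s ^ 4))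
        + n * (n + 2) * (n + 4) * s ^ 6)))"
      by (intro has_bochner_integral_add has_bochner_integral_mult_right P21 P12 X S)
    also have "(\<lambda>x. \<xi> x ^ 3 + (3 * (\<xi> x ^ 2 * S x) + (3 * (\<xi> x * S x ^ 2) + S x ^ 3)))
      = (\<lambda>x. (\<xi> x + S x) ^ 3)"
      by (simp add: fun_eq_iff power2_eq_square power3_eq_cube algebra_simps)
    also have "15 * s ^ 6 + (3 * (3 * s ^ 4 * (n * s ^ 2)) + (3 * (s ^ 2 * (n * (n + 2) * s ^ 4))
        + n * (n + 2) * (n + 4) * s ^ 6)) = (n + 1) * (n + 1 + 2) * (n + 1 + 4) * s ^ 6"
      by algebra
    finally have 3: "has_bochner_integral M (\<lambda>x. (\<xi> x + S x) ^ 3)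
      ((n + 1) * (n + 1 + 2) * (n + 1 + 4) * s ^ 6)" .
    show ?case unfolding e c using 1 2 3 by blast
  qed
  then show "has_bochner_integral M (\<lambda>x. \<Sum>i\<in>I. (Z i x)\<^sup>2) (n * s ^ 2)"
    and "has_bochner_integral M (\<lambda>x. (\<Sum>i\<in>I. (Z i x)\<^sup>2) ^ 2) (n * (n + 2) * s ^ 4)"
    and "has_bochner_integral M (\<lambda>x. (\<Sum>i\<in>I. (Z i x)\<^sup>2) ^ 3) (n * (n + 2) * (n + 4) * s ^ 6)"
    by (simp_all add: n_def)
qed

text \<open>The squared norm is scaled to mean 1, where the cubic majorant is tangent to the square
  root. Its linear term then averages to 0, and the second and third central moments
  \<open>2 / n\<close> and \<open>8 / n^2\<close> leave the mean
  \<open>1 - 1 / (5 * n) + 4 / (25 * n^2)\<close>.\<close>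

lemma (in prob_space) expectation_norm_normal_vector_le:
  fixes Z :: "'i \<Rightarrow> 'a \<Rightarrow> real"
  assumes I: "finite I" "I \<noteq> {}" and ind: "indep_vars (\<lambda>_. borel) Z I" and s: "0 < s"
    and D: "\<And>i. i \<in> I \<Longrightarrow> distributed M lborel (Z i) (\<lambda>x. ennreal (normal_density 0 s x))"
  shows "(\<integral>\<^sup>+x. ennreal (sqrt (\<Sum>i\<in>I. (Z i x)\<^sup>2)) \<partial>M)
    \<le> ennreal (sqrt (real (card I)) * s * (1 - 1 / (25 * real (card I))))"
proof -
  define n where "n = real (card I)"
  have n: "1 \<le> n" using I by (simp add: n_def Suc_le_eq card_gt_0_iff)
  define U where "U = (\<lambda>x. \<Sum>i\<in>I. (Z i x)\<^sup>2)"
  define c where "c = 1 / (n * s ^ 2)"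
  have c: "0 < c" using n s by (simp add: c_def)
  define p where "p = (\<lambda>u::real. 1 + (u - 1) / 2 - (u - 1)\<^sup>2 / 10 + (u - 1) ^ 3 / 50)"
  have U0: "0 \<le> U x" for x by (simp add: U_def sum_nonneg)
  note m = sum_squares_normal_moments[OF I(1) ind s D, folded n_def]
  have m1: "has_bochner_integral M (\<lambda>x. U x) (n * s ^ 2)"
    and m2: "has_bochner_integral M (\<lambda>x. U x ^ 2) (n * (n + 2) * s ^ 4)"
    and m3: "has_bochner_integral M (\<lambda>x. U x ^ 3) (n * (n + 2) * (n + 4) * s ^ 6)"
    using m by (simp_all add: U_def)
  have m0: "has_bochner_integral M (\<lambda>x. 1::real) 1"
    by (simp add: has_bochner_integral_iff prob_space)
  \<comment> \<open>The coefficients are those of \<open>p\<close> expanded in powers of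
    \<open>u\<close> instead of \<open>u - 1\<close>, since the moments at hand are not
    centered.\<close>
  have "has_bochner_integral M (\<lambda>x. 19/50 * 1 + (38/50 * c * U x + ((- 8/50 * c^2) * U x ^ 2 + 1/50 * c^3 * U x ^ 3)))
    (19/50 * 1 + (38/50 * c * (n * s ^ 2) + ((- 8/50 * c^2) * (n * (n + 2) * s ^ 4)
      + 1/50 * c^3 * (n * (n + 2) * (n + 4) * s ^ 6))))" (is "has_bochner_integral M _ ?E")
    by (intro has_bochner_integral_add has_bochner_integral_mult_right m0 m1 m2 m3)
  also have "(\<lambda>x. 19/50 * 1 + (38/50 * c * U x + ((- 8/50 * c^2) * U x ^ 2 + 1/50 * c^3 * U x ^ 3)))
     = (\<lambda>x. p (c * U x))"
    by (simp add: p_def fun_eq_iff power2_eq_square power3_eq_cube field_simps)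
  finally have P: "has_bochner_integral M (\<lambda>x. p (c * U x)) ?E" .
  have e: "c * (n * s ^ 2) = 1" "c^2 * (n * (n + 2) * s ^ 4) = 1 + 2 / n"
    "c^3 * (n * (n + 2) * (n + 4) * s ^ 6) = 1 + 6 / n + 8 / n^2"
    using n s by (simp_all add: c_def field_simps power2_eq_square power3_eq_cube power_numeral_reduce)
  have "?E = 19/50 + 38/50 * (c * (n * s ^ 2)) - 8/50 * (c^2 * (n * (n + 2) * s ^ 4))
     + 1/50 * (c^3 * (n * (n + 2) * (n + 4) * s ^ 6))"
    by (simp add: algebra_simps)
  also have "\<dots> = 1 - 1/5 / n + 8/50 / n^2"
    unfolding e using n by (simp add: field_simps)
  \<comment> \<open>Origin of the constant 25: \<open>8/50 / n^2\<close> is at most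
    \<open>8/50 / n\<close>, and \<open>1/5 - 8/50 = 1/25\<close>. Equality holds for
    \<open>n = 1\<close>.\<close>
  also have "\<dots> \<le> 1 - 1 / (25 * n)"
    using n by (simp add: field_simps power2_eq_square)
  finally have E: "?E \<le> 1 - 1 / (25 * n)" .
  have le: "sqrt (U x) \<le> sqrt n * s * p (c * U x)" for x
  proof -
    have "sqrt (U x) = sqrt n * s * sqrt (c * U x)"
      using n s by (simp add: c_def real_sqrt_mult real_sqrt_divide)
    also have "\<dots> \<le> sqrt n * s * p (c * U x)"
      unfolding p_def using c U0 n s by (intro mult_left_mono sqrt_le_cubic) auto
    finally show ?thesis .
  qed
  have "(\<integral>\<^sup>+x. ennreal (sqrt (U x)) \<partial>M) \<le> (\<integral>\<^sup>+x. ennreal (sqrt n * s * p (c * U x)) \<partial>M)"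
    by (intro nn_integral_mono ennreal_leI le)
  also have "\<dots> = ennreal (\<integral>x. sqrt n * s * p (c * U x) \<partial>M)"
  proof (rule nn_integral_eq_integral)
    show "integrable M (\<lambda>x. sqrt n * s * p (c * U x))"
      using P by (intro integrable_mult_right) (auto simp: has_bochner_integral_iff)
    show "AE x in M. 0 \<le> sqrt n * s * p (c * U x)"
      using le U0 by (intro AE_I2 order_trans[OF _ le]) auto
  qed
  also have "(\<integral>x. sqrt n * s * p (c * U x) \<partial>M) = sqrt n * s * ?E"
    using P by (simp add: has_bochner_integral_iff)
  also have "ennreal (sqrt n * s * ?E) \<le> ennreal (sqrt n * s * (1 - 1 / (25 * n)))"
    using E n s by (intro ennreal_leI mult_left_mono) auto
  finally show ?thesis by (simp add: U_def n_def)
qed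

section \<open>Products of consecutive layers\<close>

text \<open>\<open>seg d W i m\<close> is the product of the layers \<open>W (i + m)\<close>, ..., \<open>W (i + 1)\<close>.\<close>

definition seg :: "(nat \<Rightarrow> nat) \<Rightarrow> (nat \<Rightarrow> mat) \<Rightarrow> nat \<Rightarrow> nat \<Rightarrow> mat" where
  "seg d W i m = prodW (\<lambda>k. d (i + k)) (\<lambda>k. W (i + k)) m"

lemma seg_0: "seg d W i 0 = (\<lambda>a b. if a = b then 1 else 0)"
  by (simp add: seg_def)

lemma seg_Suc: "seg d W i (Suc m) = mmul (d (i + m)) (W (Suc (i + m))) (seg d W i m)"
  by (simp add: seg_def)

lemma prodW_eq_seg: "prodW d W L = seg d W 0 L"
  by (simp add: seg_def)

lemma seg_cong: "(\<And>k. i < k \<Longrightarrow> k \<le> i + m \<Longrightarrow> W k = V k) \<Longrightarrow> seg d W i m = seg d V i m"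
  by (induction m) (simp_all add: seg_0 seg_Suc)

lemma mmul_assoc: "mmul p (mmul q A B) C = mmul q A (mmul p B C)"
proof (intro ext)
  fix i j
  have "mmul p (mmul q A B) C i j = (\<Sum>k<p. \<Sum>l<q. A i l * B l k * C k j)"
    by (simp add: mmul_def sum_distrib_right)
  also have "\<dots> = (\<Sum>l<q. \<Sum>k<p. A i l * B l k * C k j)"
    by (rule sum.swap)
  also have "\<dots> = mmul q A (mmul p B C) i j"
    by (simp add: mmul_def sum_distrib_left mult.assoc)
  finally show "mmul p (mmul q A B) C i j = mmul q A (mmul p B C) i j" .
qed

lemma mmul_cong:
  assumes "\<And>k. k < m \<Longrightarrow> A i k = A' i k" "\<And>k. k < m \<Longrightarrow> B k j = B' k j"
  shows "mmul m A B i j = mmul m A' B' i j"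
  using assms by (auto simp: mmul_def intro!: sum.cong)

lemma mmul_add_left: "mmul m (\<lambda>a b. A a b + B a b) C i j = mmul m A C i j + mmul m B C i j"
  by (simp add: mmul_def distrib_right sum.distrib)

lemma mmul_add_right: "mmul m A (\<lambda>a b. B a b + C a b) i j = mmul m A B i j + mmul m A C i j"
  by (simp add: mmul_def distrib_left sum.distrib)

lemma mmul_identity_left: "i < m \<Longrightarrow> mmul m (\<lambda>a b. if a = b then 1 else 0) A i j = A i j"
  by (simp add: mmul_def if_distrib[of "\<lambda>x. x * _"] cong: if_cong)

lemma mmul_identity_right: "j < m \<Longrightarrow> mmul m A (\<lambda>a b. if a = b then 1 else 0) i j = A i j"
  by (simp add: mmul_def if_distrib[of "\<lambda>x. _ * x"] cong: if_cong)

text \<open>Matrices are total functions, so the row has to lie inside the dimension: for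
  \<open>k = 0\<close> the left factor is an identity truncated to \<open>d (i + m)\<close>
  summands, which reproduces only the rows below that bound.\<close>

lemma seg_append:
  assumes "a < d (i + m + k)"
  shows "seg d W i (m + k) a b = mmul (d (i + m)) (seg d W (i + m) k) (seg d W i m) a b"
  using assms
proof (induction k arbitrary: a)
  case 0
  then show ?case by (simp add: seg_0 mmul_identity_left)
next
  case (Suc k)
  have "seg d W i (m + Suc k) a b = mmul (d (i + m + k)) (W (Suc (i + m + k))) (seg d W i (m + k)) a b"
    by (simp add: seg_Suc add.assoc)
  also have "\<dots> = mmul (d (i + m + k)) (W (Suc (i + m + k))) (mmul (d (i + m)) (seg d W (i + m) k) (seg d W i m)) a b"
    by (intro mmul_cong refl Suc.IH)
  also have "\<dots> = mmul (d (i + m)) (seg d W (i + m) (Suc k)) (seg d W i m) a b"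
    by (simp add: mmul_assoc seg_Suc)
  finally show ?case .
qed

section \<open>Frobenius norm estimates\<close>

lemma fro_eq_L2_set: "fro p q A = L2_set (\<lambda>(a, b). A a b) ({..<p} \<times> {..<q})"
  by (simp add: fro_def L2_set_def sum.cartesian_product case_prod_unfold)

lemma fro_nonneg: "0 \<le> fro p q A"
  by (simp add: fro_eq_L2_set)

lemma fro_power2: "(fro p q A)\<^sup>2 = (\<Sum>a<p. \<Sum>b<q. (A a b)\<^sup>2)"
  by (simp add: fro_def sum_nonneg)

lemma fro_cong: "(\<And>a b. a < p \<Longrightarrow> b < q \<Longrightarrow> A a b = B a b) \<Longrightarrow> fro p q A = fro p q B"
  by (auto simp: fro_def intro!: sum.cong arg_cong[of _ _ sqrt])

lemma fro_add_le: "fro p q (\<lambda>a b. A a b + B a b) \<le> fro p q A + fro p q B"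
  using L2_set_triangle_ineq[of "\<lambda>(a, b). A a b" "\<lambda>(a, b). B a b"]
  by (simp add: fro_eq_L2_set case_prod_unfold)

lemma fro_scale: "fro p q (\<lambda>a b. c * A a b) = \<bar>c\<bar> * fro p q A"
  by (simp add: fro_def power_mult_distrib sum_distrib_left[symmetric] real_sqrt_mult)

lemma fro_diff_le: "fro p q (\<lambda>a b. A a b - B a b) \<le> fro p q A + fro p q B"
  using fro_add_le[of p q A "\<lambda>a b. -1 * B a b"] fro_scale[of p q "-1" B] by simp

lemma fro_diff_ge: "fro p q B - fro p q A \<le> fro p q (\<lambda>a b. A a b - B a b)"
  using fro_diff_le[of p q A "\<lambda>a b. A a b - B a b"] by simp

lemma fro_mmul_le: "fro p q (mmul m A B) \<le> fro p m A * fro m q B"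
proof (rule power2_le_imp_le)
  have "(fro p q (mmul m A B))\<^sup>2 \<le> (\<Sum>a<p. \<Sum>b<q. (\<Sum>k<m. (A a k)\<^sup>2) * (\<Sum>k<m. (B k b)\<^sup>2))"
    unfolding fro_power2 mmul_def by (intro sum_mono Cauchy_Schwarz_ineq_sum)
  also have "\<dots> = (\<Sum>a<p. \<Sum>k<m. (A a k)\<^sup>2) * (\<Sum>b<q. \<Sum>k<m. (B k b)\<^sup>2)"
    by (simp add: sum_product)
  also have "(\<Sum>b<q. \<Sum>k<m. (B k b)\<^sup>2) = (\<Sum>k<m. \<Sum>b<q. (B k b)\<^sup>2)"
    by (rule sum.swap)
  finally show "(fro p q (mmul m A B))\<^sup>2 \<le> (fro p m A * fro m q B)\<^sup>2"
    by (simp add: power_mult_distrib fro_power2)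
qed (simp add: fro_nonneg)

text \<open>A column of a layer product is the image of a fixed basis vector, whose mean length can
  be followed layer by layer. Passing to columns costs only the number of columns, which is
  polynomial in the depth.\<close>

lemma fro_le_sum_columns: "fro p q A \<le> (\<Sum>b<q. L2_set (\<lambda>a. A a b) {..<p})"
proof -
  have "fro p q A = L2_set (\<lambda>b. L2_set (\<lambda>a. A a b) {..<p}) {..<q}"
    by (simp add: fro_def L2_set_def sum_nonneg sum.swap[of _ "{..<p}"])
  also have "\<dots> \<le> (\<Sum>b<q. L2_set (\<lambda>a. A a b) {..<p})"
    by (intro L2_set_le_sum) simp
  finally show ?thesis .
qed

lemma fro_le_entry_bound:
  assumes "\<And>a b. a < p \<Longrightarrow> b < q \<Longrightarrow> \<bar>A a b\<bar> \<le> e" "real p \<le> D" "real q \<le> D" "0 \<le> e"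
  shows "fro p q A \<le> D * e"
proof (rule power2_le_imp_le)
  have D: "0 \<le> D" using assms(2) by linarith
  have "(A a b)\<^sup>2 \<le> e\<^sup>2" if "a < p" "b < q" for a b
    using power_mono[OF assms(1)[OF that], of 2] by simp
  then have "(fro p q A)\<^sup>2 \<le> (\<Sum>a<p. \<Sum>b<q. e\<^sup>2)"
    unfolding fro_power2 by (intro sum_mono) auto
  also have "\<dots> = (real p * real q) * e\<^sup>2" by simp
  also have "\<dots> \<le> (D * D) * e\<^sup>2"
    using assms D by (intro mult_right_mono mult_mono) auto
  finally show "(fro p q A)\<^sup>2 \<le> (D * e)\<^sup>2"
    by (simp add: power2_eq_square algebra_simps)
  show "0 \<le> D * e" using D assms(4) by simp
qed

section \<open>Stability of layer products under relative perturbations\<close>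

definition segprod :: "(nat \<Rightarrow> real) \<Rightarrow> nat \<Rightarrow> nat \<Rightarrow> real" where
  "segprod \<rho> i m = (\<Prod>l<m. \<rho> (Suc (i + l)))"

lemma segprod_Suc: "segprod \<rho> i (Suc m) = segprod \<rho> i m * \<rho> (Suc (i + m))"
  by (simp add: segprod_def)

text \<open>Exact multiplicativity is the reason for keeping the loss of each layer inside its own
  factor: bounds for the pieces on the two sides of a cut recombine to the bound for the whole,
  without losing any of the decay.\<close>

lemma segprod_append: "segprod \<rho> i (m + k) = segprod \<rho> i m * segprod \<rho> (i + m) k"
  by (induction k) (simp_all add: segprod_def add.assoc)

lemma segprod_pos:
  "(\<And>k. i < k \<Longrightarrow> k \<le> i + m \<Longrightarrow> 0 < \<rho> k) \<Longrightarrow> 0 < segprod \<rho> i m"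
  by (auto simp: segprod_def intro!: prod_pos)

lemma segprod_eq_prod: "segprod \<rho> 0 L = (\<Prod>i\<in>{1..L}. \<rho> i)"
  by (induction L) (simp_all add: segprod_def mult.commute)

text \<open>The factors of the perturbed product are exchanged one at a time, from the left; this avoids
  the expansion over all subsets of perturbed layers.\<close>

lemma seg_perturbation:
  assumes fro_W: "\<And>i m. i + m \<le> L \<Longrightarrow> fro (d (i + m)) (d i) (seg d W i m) \<le> B * segprod \<rho> i m"
    and dev: "\<And>k. 1 \<le> k \<Longrightarrow> k \<le> L \<Longrightarrow> fro (d k) (d (k - 1)) (\<lambda>a b. V k a b - W k a b) \<le> \<delta> * \<rho> k"
    and \<rho>: "\<And>k. 1 \<le> k \<Longrightarrow> k \<le> L \<Longrightarrow> 0 < \<rho> k"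
    and B: "0 \<le> B" and \<delta>: "0 \<le> \<delta>" and small: "real L * (2 * B * \<delta>) \<le> 1"
    and "i + m + k \<le> L"
  shows "fro (d (i + m + k)) (d i) (mmul (d (i + m)) (seg d W (i + m) k) (seg d V i m))
    \<le> B * segprod \<rho> i (m + k) * (1 + real m * (2 * B * \<delta>))"
  using \<open>i + m + k \<le> L\<close>
\<comment> \<open>\<open>k\<close> varies because peeling a layer off the perturbed block lengthens
  the unperturbed block to its left by one.\<close>
proof (induction m arbitrary: k)
  case 0
  have "fro (d (i + 0 + k)) (d i) (mmul (d (i + 0)) (seg d W (i + 0) k) (seg d V i 0))
    = fro (d (i + k)) (d i) (seg d W i k)"
    by (simp add: seg_0) (rule fro_cong, simp add: mmul_identity_right)
  then show ?case using fro_W[of i k] 0 by simp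
next
  case (Suc m)
  define x where "x = 2 * B * \<delta>"
  have x: "0 \<le> x" using B \<delta> by (simp add: x_def)
  let ?j = "Suc (i + m)"
  let ?A = "mmul (d ?j) (seg d W ?j k)" and ?V = "seg d V i m"
  let ?D = "\<lambda>a b. V ?j a b - W ?j a b"
  have pos: "0 < segprod \<rho> i' m'" if "i' + m' \<le> L" for i' m'
    using that by (intro segprod_pos \<rho>) auto
  \<comment> \<open>The last layer of the perturbed block is written as \<open>W + (V - W)\<close>.
    Its \<open>W\<close> part merges with the unperturbed block, which is the induction hypothesis
    for \<open>Suc k\<close>; the remaining term contains the difference once.\<close>
  have eq: "?A (seg d V i (Suc m)) a b
     = mmul (d (i + m)) (seg d W (i + m) (Suc k)) ?V a b + ?A (mmul (d (i + m)) ?D ?V) a b"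
    if "a < d (i + Suc m + k)" for a b
  proof -
    have "?A (seg d V i (Suc m)) a b = ?A (mmul (d (i + m)) (W ?j) ?V) a b
        + ?A (mmul (d (i + m)) ?D ?V) a b"
    proof -
      have "seg d V i (Suc m) = (\<lambda>a b. mmul (d (i + m)) (W ?j) ?V a b + mmul (d (i + m)) ?D ?V a b)"
        by (simp add: seg_Suc fun_eq_iff flip: mmul_add_left)
      then show ?thesis by (simp add: mmul_add_right)
    qed
    also have "?A (mmul (d (i + m)) (W ?j) ?V) a b
        = mmul (d (i + m)) (?A (W ?j)) ?V a b"
      by (simp add: mmul_assoc)
    also have "\<dots> = mmul (d (i + m)) (seg d W (i + m) (Suc k)) ?V a b"
    proof (rule mmul_cong[OF _ refl])
      fix l assume l: "l < d (i + m)"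
      have "seg d W (i + m) 1 b' l = W ?j b' l" for b'
        using l by (simp add: seg_Suc seg_0 mmul_identity_right)
      then have "?A (W ?j) a l = ?A (seg d W (i + m) 1) a l"
        by (intro mmul_cong) auto
      also have "\<dots> = seg d W (i + m) (1 + k) a l"
        using that by (subst seg_append) simp_all
      finally show "?A (W ?j) a l = seg d W (i + m) (Suc k) a l" by simp
    qed
    finally show ?thesis .
  qed
  \<comment> \<open>The case of an empty unperturbed block, with the accumulated error crudely
    bounded by a factor 2. This factor is the 2 in \<open>x = 2 * B * \<delta>\<close>.\<close>
  have F0: "fro (d (i + m)) (d i) ?V \<le> 2 * B * segprod \<rho> i m"
  proof -
    have "fro (d (i + m)) (d i) ?V
        = fro (d (i + m + 0)) (d i) (mmul (d (i + m)) (seg d W (i + m) 0) ?V)"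
      by (simp add: seg_0) (rule fro_cong, simp add: mmul_identity_left)
    also have "\<dots> \<le> B * segprod \<rho> i (m + 0) * (1 + real m * x)"
      unfolding x_def using Suc.prems by (intro Suc.IH) auto
    also have "\<dots> \<le> B * segprod \<rho> i m * 2"
    proof -
      have "real m * x \<le> real L * x" using Suc.prems x by (intro mult_right_mono) auto
      then show ?thesis
        using small[folded x_def] B pos[of i m] Suc.prems
        unfolding add_0_right by (intro mult_left_mono) auto
    qed
    finally show ?thesis by simp
  qed
  have "fro (d (i + Suc m + k)) (d i) (?A (seg d V i (Suc m)))
     \<le> fro (d (i + Suc m + k)) (d i) (mmul (d (i + m)) (seg d W (i + m) (Suc k)) ?V)
       + fro (d (i + Suc m + k)) (d i) (?A (mmul (d (i + m)) ?D ?V))"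
    by (intro order_trans[OF _ fro_add_le] eq_refl fro_cong eq)
  also have "fro (d (i + Suc m + k)) (d i) (mmul (d (i + m)) (seg d W (i + m) (Suc k)) ?V)
     \<le> B * segprod \<rho> i (Suc m + k) * (1 + real m * x)"
    using Suc.IH[of "Suc k"] Suc.prems by (simp add: x_def)
  \<comment> \<open>The three pieces contribute \<open>B\<close>, \<open>\<delta>\<close> and
    \<open>2 * B\<close>, each times its own part of the product of factors, so one exchange adds
    exactly \<open>x\<close> to the relative error.\<close>
  also have "fro (d (i + Suc m + k)) (d i) (?A (mmul (d (i + m)) ?D ?V))
     \<le> (B * segprod \<rho> ?j k) * ((\<delta> * \<rho> ?j) * (2 * B * segprod \<rho> i m))"
  proof (intro order_trans[OF fro_mmul_le] mult_mono)
    show "fro (d (i + Suc m + k)) (d ?j) (seg d W ?j k) \<le> B * segprod \<rho> ?j k"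
      using fro_W[of ?j k] Suc.prems by simp
    show "fro (d ?j) (d (i + m)) ?D \<le> \<delta> * \<rho> ?j"
      using dev[of ?j] Suc.prems by simp
  qed (use F0 B \<delta> pos[of ?j k] pos[of i m] \<rho>[of ?j] Suc.prems in \<open>auto simp: fro_nonneg\<close>)
  also have "\<dots> = B * segprod \<rho> i (Suc m + k) * x"
    unfolding segprod_append[of \<rho> i "Suc m" k] by (simp add: segprod_Suc x_def)
  finally show ?case
    by (simp add: x_def algebra_simps)
qed

corollary fro_seg_perturbed_le:
  assumes fro_W: "\<And>i m. i + m \<le> L \<Longrightarrow> fro (d (i + m)) (d i) (seg d W i m) \<le> B * segprod \<rho> i m"
    and dev: "\<And>k. 1 \<le> k \<Longrightarrow> k \<le> L \<Longrightarrow> fro (d k) (d (k - 1)) (\<lambda>a b. V k a b - W k a b) \<le> \<delta> * \<rho> k"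
    and \<rho>: "\<And>k. 1 \<le> k \<Longrightarrow> k \<le> L \<Longrightarrow> 0 < \<rho> k"
    and B: "0 \<le> B" and \<delta>: "0 \<le> \<delta>" and small: "real L * (2 * B * \<delta>) \<le> 1"
    and im: "i + m \<le> L"
  shows "fro (d (i + m)) (d i) (seg d V i m) \<le> 2 * B * segprod \<rho> i m"
proof -
  have "fro (d (i + m)) (d i) (seg d V i m)
      = fro (d (i + m + 0)) (d i) (mmul (d (i + m)) (seg d W (i + m) 0) (seg d V i m))"
    by (simp add: seg_0) (rule fro_cong, simp add: mmul_identity_left)
  also have "\<dots> \<le> B * segprod \<rho> i (m + 0) * (1 + real m * (2 * B * \<delta>))"
    using im by (intro seg_perturbation[OF assms(1-6)]) auto
  also have "\<dots> \<le> B * segprod \<rho> i m * 2"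
  proof -
    have "real m * (2 * B * \<delta>) \<le> real L * (2 * B * \<delta>)"
      using im B \<delta> by (intro mult_right_mono) auto
    moreover have "0 < segprod \<rho> i m" using im by (intro segprod_pos \<rho>) auto
    ultimately show ?thesis
      using small B unfolding add_0_right by (intro mult_left_mono) auto
  qed
  finally show ?thesis by simp
qed

section \<open>Layer products at initialization\<close>

abbreviation normal_law :: "(nat \<Rightarrow> real) \<Rightarrow> nat \<times> nat \<times> nat \<Rightarrow> real measure" where
  "normal_law \<sigma> p \<equiv> density lborel (\<lambda>x. ennreal (normal_density 0 (\<sigma> (fst p)) x))"

text \<open>Independence is checked through the joint law: the coordinates taken together are the
  identity map, whose law is the product measure itself, and its factors are the laws of the single
  coordinates.\<close>

lemma indep_vars_PiM_coordinates:
  assumes "\<And>p. p \<in> J \<Longrightarrow> prob_space (N p)" and N: "\<And>p. p \<in> J \<Longrightarrow> sets (N p) = sets borel"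
    and "J \<noteq> {}"
  shows "prob_space.indep_vars (PiM J N) (\<lambda>_. borel :: real measure) (\<lambda>p \<omega>. \<omega> p) J"
proof -
  interpret P: prob_space "PiM J N" by (rule prob_space_PiM) (use assms in auto)
  have sp: "sets (PiM J (\<lambda>_. borel)) = sets (PiM J N)"
    using N by (intro sets_PiM_cong) auto
  have rv: "(\<lambda>\<omega>. \<omega> p) \<in> borel_measurable (PiM J N)" if "p \<in> J" for p
    using measurable_component_singleton[OF that, of N] N[OF that] by (simp cong: measurable_cong_sets)
  have "distr (PiM J N) (PiM J (\<lambda>_. borel)) (\<lambda>x. \<lambda>i\<in>J. x i) = distr (PiM J N) (PiM J N) (\<lambda>x. x)"
    using sp by (intro distr_cong) (auto simp: space_PiM PiE_def extensional_restrict)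
  also have "\<dots> = PiM J N" by (rule distr_id2) simp
  also have "\<dots> = PiM J (\<lambda>p. distr (PiM J N) borel (\<lambda>\<omega>. \<omega> p))"
  proof (rule PiM_cong[OF refl])
    fix p assume p: "p \<in> J"
    have "N p = distr (PiM J N) (N p) (\<lambda>\<omega>. \<omega> p)"
      using assms(1) p by (intro distr_PiM_component[symmetric])
    also have "\<dots> = distr (PiM J N) borel (\<lambda>\<omega>. \<omega> p)"
      using N[OF p] by (intro distr_cong) auto
    finally show "N p = distr (PiM J N) borel (\<lambda>\<omega>. \<omega> p)" .
  qed
  finally show ?thesis
    using assms(3) rv by (subst P.indep_vars_iff_distr_eq_PiM') auto
qed

text \<open>Different rows use disjoint sets of entries, so the coordinates of the image of
  \<open>v\<close> are independent and normal with the common standard deviation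
  \<open>\<sigma> k * L2_set v {..<q}\<close>. The estimate for Gaussian vectors then
  applies.\<close>

lemma nn_integral_norm_gaussian_layer_le:
  fixes v :: "nat \<Rightarrow> real" and p q :: nat
  assumes \<sigma>: "0 < \<sigma> k" and p: "0 < p"
  defines "J \<equiv> {k} \<times> {..<p} \<times> {..<q}"
  shows "(\<integral>\<^sup>+y. ennreal (L2_set (\<lambda>a. \<Sum>b<q. y (k, a, b) * v b) {..<p}) \<partial>PiM J (normal_law \<sigma>))
    \<le> ennreal (sqrt (real p) * \<sigma> k * (1 - 1 / (25 * real p)) * L2_set v {..<q})"
\<comment> \<open>For a zero vector the image is a point mass, which has no normal density, but both
  sides vanish.\<close>
proof (cases "\<forall>b<q. v b = 0")
  case True
  then have "(\<Sum>b<q. y (k, a, b) * v b) = 0" for y :: "nat \<times> nat \<times> nat \<Rightarrow> real" and a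
    by (intro sum.neutral) auto
  then show ?thesis by (simp add: L2_set_def)
next
  case False
  define P where "P = PiM J (normal_law \<sigma>)"
  have PJ: "prob_space (normal_law \<sigma> x)" if "x \<in> J" for x
    using that \<sigma> by (auto simp: J_def intro!: prob_space_normal_density)
  interpret P: prob_space P unfolding P_def by (rule prob_space_PiM) (fact PJ)
  have ind: "P.indep_vars (\<lambda>_. borel) (\<lambda>x \<omega>. \<omega> x) J"
    unfolding P_def by (rule indep_vars_PiM_coordinates) (use PJ False p in \<open>auto simp: J_def\<close>)
  have rv: "(\<lambda>\<omega>. \<omega> x) \<in> borel_measurable P" if "x \<in> J" for x
    using ind that by (auto simp: P.indep_vars_def)
  have dist: "distributed P lborel (\<lambda>\<omega>. \<omega> x) (\<lambda>x. ennreal (normal_density 0 (\<sigma> k) x))" if x: "x \<in> J" for x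
    unfolding distributed_def
  proof (intro conjI)
    have "distr P lborel (\<lambda>\<omega>. \<omega> x) = distr P (normal_law \<sigma> x) (\<lambda>\<omega>. \<omega> x)"
      by (intro distr_cong) auto
    also have "\<dots> = normal_law \<sigma> x"
      unfolding P_def by (rule distr_PiM_component[OF PJ x])
    finally show "distr P lborel (\<lambda>\<omega>. \<omega> x) = density lborel (\<lambda>x. ennreal (normal_density 0 (\<sigma> k) x))"
      using x by (auto simp: J_def)
  qed (use rv[OF x] in auto)
  define s where "s = \<sigma> k * L2_set v {..<q}"
  define Z where "Z = (\<lambda>(a::nat) \<omega>. \<Sum>b<q. \<omega> (k, a, b) * v b)"
  \<comment> \<open>The summands with \<open>v b = 0\<close> are dropped: scaling by zero would
    again leave the class of laws with a normal density.\<close>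
  define Bv where "Bv = {b. b < q \<and> v b \<noteq> 0}"
  have Bv: "finite Bv" "Bv \<noteq> {}" using False by (auto simp: Bv_def)
  have s: "0 < s"
    using False \<sigma> by (auto simp: s_def L2_set_def intro!: mult_pos_pos sum_pos2)
  have indZ: "P.indep_vars (\<lambda>_. borel) Z {..<p}"
  proof -
    have "P.indep_vars (\<lambda>a. PiM ({k} \<times> {a} \<times> {..<q}) (\<lambda>_. borel))
        (\<lambda>a \<omega>. restrict (\<lambda>x. \<omega> x) ({k} \<times> {a} \<times> {..<q})) {..<p}"
      by (rule P.indep_vars_restrict[OF ind]) (auto simp: J_def disjoint_family_on_def)
    then have "P.indep_vars (\<lambda>_. borel)
        (\<lambda>a \<omega>. (\<lambda>f. \<Sum>b<q. f (k, a, b) * v b) (restrict (\<lambda>x. \<omega> x) ({k} \<times> {a} \<times> {..<q}))) {..<p}"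
      by (rule P.indep_vars_compose2) measurable
    then show ?thesis
      by (rule P.indep_vars_cong[THEN iffD1, rotated -1]) (auto simp: Z_def)
  qed
  have distZ: "distributed P lborel (Z a) (\<lambda>x. ennreal (normal_density 0 s x))" if a: "a < p" for a
  proof -
    let ?I = "(\<lambda>b. (k, a, b)) ` Bv"
    have sub: "?I \<subseteq> J" using a by (auto simp: J_def Bv_def)
    have "P.indep_vars (\<lambda>_. borel) (\<lambda>x \<omega>. \<omega> x) ?I"
      by (rule P.indep_vars_subset[OF ind sub])
    then have 1: "P.indep_vars (\<lambda>_. borel) (\<lambda>x \<omega>. v (snd (snd x)) * \<omega> x) ?I"
      by (rule P.indep_vars_compose2) measurable
    have 2: "distributed P lborel (\<lambda>\<omega>. v (snd (snd x)) * \<omega> x)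
        (\<lambda>y. ennreal (normal_density 0 (\<bar>v (snd (snd x))\<bar> * \<sigma> k) y))" if "x \<in> ?I" for x
      using P.normal_density_affine[OF dist[of x] \<sigma>, of "v (snd (snd x))" 0] that sub
      by (auto simp: Bv_def)
    have "distributed P lborel (\<lambda>\<omega>. \<Sum>x\<in>?I. v (snd (snd x)) * \<omega> x)
        (\<lambda>y. ennreal (normal_density (\<Sum>x\<in>?I. 0) (sqrt (\<Sum>x\<in>?I. (\<bar>v (snd (snd x))\<bar> * \<sigma> k)\<^sup>2)) y))"
      by (rule P.sum_indep_normal[OF _ _ 1]) (use Bv \<sigma> 2 in \<open>auto simp: Bv_def\<close>)
    moreover have "(\<Sum>x\<in>?I. v (snd (snd x)) * \<omega> x) = Z a \<omega>" for \<omega> :: "nat \<times> nat \<times> nat \<Rightarrow> real"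
    proof -
      have "(\<Sum>x\<in>?I. v (snd (snd x)) * \<omega> x) = (\<Sum>b\<in>Bv. v b * \<omega> (k, a, b))"
        by (subst sum.reindex) (auto simp: inj_on_def)
      also have "\<dots> = (\<Sum>b<q. v b * \<omega> (k, a, b))"
        by (rule sum.mono_neutral_left) (auto simp: Bv_def)
      finally show ?thesis by (simp add: Z_def mult.commute)
    qed
    moreover have "sqrt (\<Sum>x\<in>?I. (\<bar>v (snd (snd x))\<bar> * \<sigma> k)\<^sup>2) = s"
    proof -
      have "(\<Sum>x\<in>?I. (\<bar>v (snd (snd x))\<bar> * \<sigma> k)\<^sup>2) = (\<Sum>b\<in>Bv. (v b * \<sigma> k)\<^sup>2)"
        by (subst sum.reindex) (auto simp: inj_on_def power_mult_distrib)
      also have "\<dots> = (\<Sum>b<q. (v b * \<sigma> k)\<^sup>2)"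
        by (rule sum.mono_neutral_left) (auto simp: Bv_def)
      finally show ?thesis
        using \<sigma> by (simp add: s_def L2_set_def power_mult_distrib real_sqrt_mult flip: sum_distrib_right)
    qed
    ultimately show ?thesis by simp
  qed
  have "(\<integral>\<^sup>+\<omega>. ennreal (sqrt (\<Sum>a<p. (Z a \<omega>)\<^sup>2)) \<partial>P)
      \<le> ennreal (sqrt (real (card {..<p})) * s * (1 - 1 / (25 * real (card {..<p}))))"
    by (rule P.expectation_norm_normal_vector_le[OF _ _ indZ s distZ]) (use p in auto)
  then show ?thesis by (simp add: Z_def P_def s_def L2_set_def mult_ac)
qed

section \<open>Measurability and first moments of layer products\<close>

lemma finite_widx: "finite (widx d L)"
proof (rule finite_subset)
  let ?D = "Max (d ` {..L})"
  have le: "d i \<le> ?D" if "i \<le> L" for i using that by (intro Max_ge) auto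
  show "widx d L \<subseteq> {..L} \<times> {..<?D} \<times> {..<?D}"
    using le by (auto simp: widx_def intro: order.strict_trans2)
qed simp

lemma to_weights_measurable:
  "(\<lambda>\<omega>. to_weights d L \<omega> i a b) \<in> borel_measurable (PiM (widx d L) (normal_law \<sigma>))"
proof (cases "(i, a, b) \<in> widx d L")
  case True
  then show ?thesis
    using measurable_component_singleton[OF True, of "normal_law \<sigma>"]
    by (simp add: to_weights_def cong: measurable_cong_sets)
qed (simp add: to_weights_def)

lemma seg_measurable:
  assumes "\<And>i a b. (\<lambda>\<omega>. W \<omega> i a b) \<in> borel_measurable M"
  shows "(\<lambda>\<omega>. seg d (W \<omega>) i m a b) \<in> borel_measurable M"
  by (induction m arbitrary: a b) (use assms in \<open>auto simp: seg_0 seg_Suc mmul_def\<close>)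

lemma L2_set_measurable:
  assumes "\<And>a. (\<lambda>\<omega>. f \<omega> a) \<in> borel_measurable M"
  shows "(\<lambda>\<omega>. L2_set (f \<omega>) A) \<in> borel_measurable M"
  using assms unfolding L2_set_def by measurable

text \<open>Integrating first over the last layer with all others fixed replaces conditioning on the
  earlier layers.\<close>

lemma nn_integral_column_seg_le:
  assumes \<sigma>: "\<And>k. 0 < \<sigma> k" and d: "\<And>k. k \<le> L \<Longrightarrow> 0 < d k" and "i + m \<le> L" and b: "b < d i"
  shows "(\<integral>\<^sup>+\<omega>. ennreal (L2_set (\<lambda>a. seg d (to_weights d L \<omega>) i m a b) {..<d (i + m)}) \<partial>init_measure d L \<sigma>)
    \<le> ennreal (segprod (\<lambda>k. sqrt (real (d k)) * \<sigma> k * (1 - 1 / (25 * real (d k)))) i m)"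
  using \<open>i + m \<le> L\<close>
proof (induction m)
  case 0
  have "prob_space (init_measure d L \<sigma>)"
    unfolding init_measure_def by (intro prob_space_PiM prob_space_normal_density \<sigma>)
  moreover have "(\<Sum>a<d i. (if a = b then 1 else 0)\<^sup>2) = (1::real)"
    using b by (simp add: if_distrib[of "\<lambda>x. x\<^sup>2"] cong: if_cong)
  ultimately show ?case
    by (simp add: seg_0 L2_set_def segprod_def prob_space.emeasure_space_1)
next
  case (Suc m)
  define \<rho> where "\<rho> = (\<lambda>k. sqrt (real (d k)) * \<sigma> k * (1 - 1 / (25 * real (d k))))"
  define k where "k = Suc (i + m)"
  define J where "J = {k} \<times> {..<d k} \<times> {..<d (i + m)}"
  define I where "I = widx d L - J"
  have k: "k \<le> L" using Suc.prems by (simp add: k_def)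
  have JW: "J \<subseteq> widx d L" using k by (auto simp: J_def widx_def k_def)
  have IJ: "I \<inter> J = {}" "finite I" "finite J" "I \<union> J = widx d L"
    using JW finite_widx[of d L] by (auto simp: I_def J_def)
  interpret N: product_prob_space "normal_law \<sigma>" UNIV
    by (rule product_prob_spaceI) (rule prob_space_normal_density[OF \<sigma>])
  interpret PJ: prob_space "PiM J (normal_law \<sigma>)"
    by (intro prob_space_PiM prob_space_normal_density \<sigma>)
  define col where "col = (\<lambda>m \<omega>. L2_set (\<lambda>a. seg d (to_weights d L \<omega>) i m a b) {..<d (i + m)})"
  have col_meas: "(\<lambda>\<omega>. ennreal (col m \<omega>)) \<in> borel_measurable (PiM (I \<union> J) (normal_law \<sigma>))" for m
    unfolding col_def IJ(4) by (intro measurable_compose[OF _ measurable_ennreal] L2_set_measurable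
        seg_measurable to_weights_measurable)
  have \<rho>: "0 < \<rho> k'" if "k' \<le> L" for k'
  proof -
    have "1 \<le> real (d k')" using d[OF that] by simp
    then show ?thesis using \<sigma> by (auto simp: \<rho>_def field_simps intro!: mult_pos_pos)
  qed
  have inner: "(\<integral>\<^sup>+y. ennreal (col (Suc m) (merge I J (x, y))) \<partial>PiM J (normal_law \<sigma>))
      \<le> (\<integral>\<^sup>+y. ennreal (\<rho> k) * ennreal (col m (merge I J (x, y))) \<partial>PiM J (normal_law \<sigma>))" for x
  proof -
    \<comment> \<open>Setting the entries of layer \<open>k\<close> to 0 is an arbitrary choice that
      makes \<open>v\<close> visibly independent of \<open>y\<close>; the earlier layers do not see
      these entries.\<close>
    define v where "v = (\<lambda>b'. seg d (to_weights d L (merge I J (x, \<lambda>_. 0))) i m b' b)"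
    have seg_v: "seg d (to_weights d L (merge I J (x, y))) i m a b = v a" for y a
    proof -
      have "seg d (to_weights d L (merge I J (x, y))) i m
          = seg d (to_weights d L (merge I J (x, \<lambda>_. 0))) i m"
        by (rule seg_cong) (auto simp: to_weights_def merge_def J_def k_def fun_eq_iff)
      then show ?thesis by (simp add: v_def)
    qed
    have W: "to_weights d L (merge I J (x, y)) k a b' = y (k, a, b')"
      if "a < d k" "b' < d (i + m)" for y a b'
    proof -
      have "(k, a, b') \<in> J" using that by (simp add: J_def)
      then show ?thesis using IJ JW by (auto simp: to_weights_def merge_def)
    qed
    have colS: "col (Suc m) (merge I J (x, y)) = L2_set (\<lambda>a. \<Sum>b'<d (i + m). y (k, a, b') * v b') {..<d k}" for y
      unfolding col_def add_Suc_right k_def[symmetric]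
      by (rule L2_set_cong[OF refl]) (simp add: seg_Suc k_def[symmetric] mmul_def seg_v W)
    have colm: "col m (merge I J (x, y)) = L2_set v {..<d (i + m)}" for y
      by (simp add: col_def seg_v)
    have "(\<integral>\<^sup>+y. ennreal (col (Suc m) (merge I J (x, y))) \<partial>PiM J (normal_law \<sigma>))
        \<le> ennreal (\<rho> k * L2_set v {..<d (i + m)})"
      unfolding colS unfolding J_def \<rho>_def by (intro nn_integral_norm_gaussian_layer_le \<sigma> d k)
    also have "\<dots> = (\<integral>\<^sup>+y. ennreal (\<rho> k) * ennreal (col m (merge I J (x, y))) \<partial>PiM J (normal_law \<sigma>))"
      using \<rho>[OF k] by (simp add: colm PJ.emeasure_space_1 ennreal_mult less_imp_le)
    finally show ?thesis .
  qed
  have "(\<integral>\<^sup>+\<omega>. ennreal (col (Suc m) \<omega>) \<partial>PiM (I \<union> J) (normal_law \<sigma>))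
      \<le> (\<integral>\<^sup>+\<omega>. ennreal (\<rho> k) * ennreal (col m \<omega>) \<partial>PiM (I \<union> J) (normal_law \<sigma>))"
    using col_meas
    by (subst (1 2) N.product_nn_integral_fold[OF IJ(1-3)]) (auto intro!: nn_integral_mono inner)
  also have "\<dots> = ennreal (\<rho> k) * (\<integral>\<^sup>+\<omega>. ennreal (col m \<omega>) \<partial>PiM (I \<union> J) (normal_law \<sigma>))"
    by (rule nn_integral_cmult[OF col_meas])
  also have "\<dots> \<le> ennreal (\<rho> k) * ennreal (segprod \<rho> i m)"
    using Suc.IH Suc.prems by (intro mult_left_mono) (auto simp: IJ(4) init_measure_def col_def \<rho>_def)
  also have "\<dots> = ennreal (segprod \<rho> i (Suc m))"
  proof -
    have "0 < segprod \<rho> i m" using Suc.prems by (intro segprod_pos \<rho>) auto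
    then show ?thesis
      using \<rho>[OF k] by (simp add: segprod_Suc k_def ennreal_mult mult.commute less_imp_le)
  qed
  finally show ?case by (simp add: IJ(4) init_measure_def col_def \<rho>_def)
qed

text \<open>One application of Markov's inequality serves all segments at once. \<open>T\<close>
  adds up all column norms divided by their bounds; it has at most \<open>(L + 1)^2 * D\<close>
  summands of mean at most 1, and being a sum of nonnegative terms it dominates the normalized
  column sum of each segment. The factor 10 is the reciprocal of the allowed failure
  probability.\<close>

lemma prob_all_seg_bounded:
  assumes \<sigma>: "\<And>k. 0 < \<sigma> k" and d: "\<And>k. k \<le> L \<Longrightarrow> 0 < d k"
    and D: "\<And>k. k \<le> L \<Longrightarrow> real (d k) \<le> D"
  defines "\<rho> \<equiv> \<lambda>k. sqrt (real (d k)) * \<sigma> k * (1 - 1 / (25 * real (d k)))"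
    and "M \<equiv> init_measure d L \<sigma>"
  shows "\<exists>G\<in>sets M. 0.9 \<le> measure M G \<and> (\<forall>\<omega>\<in>G. \<forall>i m. i + m \<le> L \<longrightarrow>
    fro (d (i + m)) (d i) (seg d (to_weights d L \<omega>) i m) \<le> 10 * (real L + 1)\<^sup>2 * D * segprod \<rho> i m)"
proof -
  interpret prob_space M
    unfolding M_def init_measure_def by (intro prob_space_PiM prob_space_normal_density \<sigma>)
  define col where "col = (\<lambda>i m b \<omega>. L2_set (\<lambda>a. seg d (to_weights d L \<omega>) i m a b) {..<d (i + m)})"
  define S where "S = segprod \<rho>"
  define T where "T = (\<lambda>\<omega>. \<Sum>i\<le>L. \<Sum>m\<le>L - i. \<Sum>b<d i. col i m b \<omega> / S i m)"
  define N where "N = (real L + 1)\<^sup>2 * D"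
  have \<rho>: "0 < \<rho> k" if "k \<le> L" for k
  proof -
    have "1 \<le> real (d k)" using d[OF that] by simp
    then show ?thesis using \<sigma> by (auto simp: \<rho>_def field_simps intro!: mult_pos_pos)
  qed
  have S: "0 < S i m" if "i + m \<le> L" for i m
    unfolding S_def using that by (intro segprod_pos \<rho>) auto
  have D1: "1 \<le> D" using D[of 0] d[of 0] by linarith
  then have N: "0 < N" by (simp add: N_def)
  have col_meas[measurable]: "col i m b \<in> borel_measurable M" for i m b
    unfolding col_def M_def init_measure_def
    by (intro L2_set_measurable seg_measurable to_weights_measurable)
  have T_meas[measurable]: "T \<in> borel_measurable M"
    unfolding T_def by measurable
  have col0: "0 \<le> col i m b \<omega>" for i m b \<omega> by (simp add: col_def)
  have T0: "0 \<le> T \<omega>" for \<omega>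
    unfolding T_def using S col0 by (intro sum_nonneg divide_nonneg_pos) auto
  have "(\<integral>\<^sup>+\<omega>. ennreal (T \<omega>) \<partial>M)
      = (\<integral>\<^sup>+\<omega>. (\<Sum>i\<le>L. \<Sum>m\<le>L - i. \<Sum>b<d i. ennreal (col i m b \<omega> / S i m)) \<partial>M)"
  proof (intro nn_integral_cong)
    fix \<omega>
    have nn: "0 \<le> col i m b \<omega> / S i m" if "i \<le> L" "m \<le> L - i" for i m b
      using S[of i m] col0 that by (simp add: less_imp_le)
    have "(\<Sum>i\<le>L. \<Sum>m\<le>L - i. \<Sum>b<d i. ennreal (col i m b \<omega> / S i m))
        = (\<Sum>i\<le>L. \<Sum>m\<le>L - i. ennreal (\<Sum>b<d i. col i m b \<omega> / S i m))"
      by (intro sum.cong refl sum_ennreal nn) auto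
    also have "\<dots> = (\<Sum>i\<le>L. ennreal (\<Sum>m\<le>L - i. \<Sum>b<d i. col i m b \<omega> / S i m))"
      by (intro sum.cong refl sum_ennreal sum_nonneg nn) auto
    also have "\<dots> = ennreal (T \<omega>)"
      unfolding T_def by (intro sum_ennreal sum_nonneg nn) auto
    finally show "ennreal (T \<omega>) = (\<Sum>i\<le>L. \<Sum>m\<le>L - i. \<Sum>b<d i. ennreal (col i m b \<omega> / S i m))" ..
  qed
  also have "\<dots> = (\<Sum>i\<le>L. \<Sum>m\<le>L - i. \<Sum>b<d i. \<integral>\<^sup>+\<omega>. ennreal (col i m b \<omega> / S i m) \<partial>M)"
    by (simp add: nn_integral_sum)
  also have "\<dots> \<le> (\<Sum>i\<le>L. \<Sum>m\<le>L - i. \<Sum>b<d i. 1)"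
  proof (intro sum_mono)
    fix i m b assume im: "i \<in> {..L}" "m \<in> {..L - i}" "b \<in> {..<d i}"
    have s: "0 < S i m" using im by (intro S) auto
    have "(\<integral>\<^sup>+\<omega>. ennreal (col i m b \<omega> / S i m) \<partial>M)
        = (\<integral>\<^sup>+\<omega>. ennreal (1 / S i m) * ennreal (col i m b \<omega>) \<partial>M)"
      using s col0 by (simp add: ennreal_mult[symmetric])
    also have "\<dots> = ennreal (1 / S i m) * (\<integral>\<^sup>+\<omega>. ennreal (col i m b \<omega>) \<partial>M)"
      by (rule nn_integral_cmult) simp
    also have "\<dots> \<le> ennreal (1 / S i m) * ennreal (S i m)"
      unfolding col_def S_def M_def \<rho>_def using im
      by (intro mult_left_mono nn_integral_column_seg_le \<sigma> d) auto
    also have "\<dots> = 1" using s by (simp add: ennreal_mult[symmetric])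
    finally show "(\<integral>\<^sup>+\<omega>. ennreal (col i m b \<omega> / S i m) \<partial>M) \<le> 1" .
  qed
  also have "\<dots> = ennreal (\<Sum>i\<le>L. \<Sum>m\<le>L - i. \<Sum>b<d i. 1)"
  proof -
    have "(\<Sum>i\<le>L. \<Sum>m\<le>L - i. \<Sum>b<d i. 1) = (of_nat (\<Sum>i\<le>L. \<Sum>m\<le>L - i. \<Sum>b<d i. 1) :: ennreal)"
      by (simp only: of_nat_sum of_nat_1)
    also have "\<dots> = ennreal (\<Sum>i\<le>L. \<Sum>m\<le>L - i. \<Sum>b<d i. 1)"
      by (simp only: ennreal_of_nat_eq_real_of_nat of_nat_sum of_nat_1)
    finally show ?thesis .
  qed
  also have "\<dots> \<le> ennreal N"
  proof (intro ennreal_leI)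
    have "(\<Sum>i\<le>L. \<Sum>m\<le>L - i. \<Sum>b<d i. 1) \<le> (\<Sum>i\<le>L. (real L + 1) * D)"
    proof (intro sum_mono)
      fix i assume i: "i \<in> {..L}"
      have "(\<Sum>m\<le>L - i. \<Sum>b<d i. 1) = (real (L - i) + 1) * real (d i)" by simp
      also have "\<dots> \<le> (real L + 1) * D" using D[of i] i by (intro mult_mono) auto
      finally show "(\<Sum>m\<le>L - i. \<Sum>b<d i. 1) \<le> (real L + 1) * D" .
    qed
    then show "(\<Sum>i\<le>L. \<Sum>m\<le>L - i. \<Sum>b<d i. 1) \<le> N"
      by (simp add: N_def power2_eq_square algebra_simps)
  qed
  finally have ET: "(\<integral>\<^sup>+\<omega>. ennreal (T \<omega>) \<partial>M) \<le> ennreal N" .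
  have Tint: "integrable M T"
    using ET T0 by (intro integrableI_nonneg) (auto intro: le_less_trans)
  have EX: "expectation T \<le> N"
    using ET T0 N Tint by (subst (asm) nn_integral_eq_integral) auto
  have "prob {\<omega> \<in> space M. 10 * N \<le> T \<omega>} \<le> expectation T / (10 * N)"
    using N T0 Tint by (intro integral_Markov_inequality_measure[where A = "space M"]) auto
  also have "\<dots> \<le> 0.1" using EX N by (simp add: field_simps)
  finally have bad: "prob {\<omega> \<in> space M. 10 * N \<le> T \<omega>} \<le> 0.1" .
  define G where "G = {\<omega> \<in> space M. T \<omega> < 10 * N}"
  have G: "G \<in> sets M" unfolding G_def by measurable
  have "prob (space M - {\<omega> \<in> space M. 10 * N \<le> T \<omega>}) = 1 - prob {\<omega> \<in> space M. 10 * N \<le> T \<omega>}"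
    by (rule prob_compl) measurable
  moreover have "space M - {\<omega> \<in> space M. 10 * N \<le> T \<omega>} = G" by (auto simp: G_def)
  ultimately have "0.9 \<le> prob G" using bad by simp
  moreover have "fro (d (i + m)) (d i) (seg d (to_weights d L \<omega>) i m) \<le> 10 * (real L + 1)\<^sup>2 * D * segprod \<rho> i m"
    if "\<omega> \<in> G" "i + m \<le> L" for \<omega> i m
  proof -
    have s: "0 < S i m" using that by (intro S) auto
    have t: "0 \<le> col i' m' b \<omega> / S i' m'" if "i' + m' \<le> L" for i' m' b
      using S[OF that] col0 by (simp add: less_imp_le)
    have "fro (d (i + m)) (d i) (seg d (to_weights d L \<omega>) i m) \<le> (\<Sum>b<d i. col i m b \<omega>)"
      unfolding col_def by (rule fro_le_sum_columns)
    also have "\<dots> = (\<Sum>b<d i. col i m b \<omega> / S i m) * S i m"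
      using s by (simp add: sum_distrib_right)
    also have "\<dots> \<le> T \<omega> * S i m"
    proof (rule mult_right_mono)
      have "(\<Sum>b<d i. col i m b \<omega> / S i m) \<le> (\<Sum>m\<le>L - i. \<Sum>b<d i. col i m b \<omega> / S i m)"
        using that by (intro member_le_sum[of m "{..L - i}" "\<lambda>m. \<Sum>b<d i. col i m b \<omega> / S i m"] sum_nonneg t) auto
      also have "\<dots> \<le> T \<omega>"
        unfolding T_def using that
        by (intro member_le_sum[of i "{..L}" "\<lambda>i. \<Sum>m\<le>L - i. \<Sum>b<d i. col i m b \<omega> / S i m"] sum_nonneg t) auto
      finally show "(\<Sum>b<d i. col i m b \<omega> / S i m) \<le> T \<omega>" .
    qed (use s in simp)
    also have "\<dots> \<le> 10 * N * S i m"
      using that s by (intro mult_right_mono) (auto simp: G_def)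
    finally show ?thesis by (simp add: N_def S_def mult.assoc)
  qed
  ultimately show ?thesis using G by blast
qed

section \<open>Gradient descent\<close>

definition residual :: "real \<Rightarrow> (nat \<Rightarrow> nat) \<Rightarrow> nat \<Rightarrow> mat \<Rightarrow> mat \<Rightarrow> (nat \<Rightarrow> mat) \<Rightarrow> mat" where
  "residual \<alpha> d L X Y W = (\<lambda>p q. \<alpha> * mmul (d 0) (prodW d W L) X p q - Y p q)"

lemma loss_eq_residual: "loss \<alpha> d L n X Y W = 1 / 2 * (fro (d L) n (residual \<alpha> d L X Y W))\<^sup>2"
  by (simp add: loss_def residual_def)

text \<open>Cutting the product at layer \<open>i\<close> shows that a single entry enters affinely.
  Its slope is an outer product: column \<open>a\<close> of the layers above times row
  \<open>b\<close> of the layers below, applied to the data.\<close>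

lemma mmul_prodW_update_entry:
  assumes i: "1 \<le> i" "i \<le> L" and ab: "a < d i" "b < d (i - 1)" and p: "p < d L"
  shows "mmul (d 0) (prodW d (W(i := (W i)(a := (W i a)(b := s)))) L) X p q
    = mmul (d 0) (prodW d W L) X p q
      + (s - W i a b) * (seg d W i (L - i) p a * mmul (d 0) (seg d W 0 (i - 1)) X b q)"
proof -
  define j where "j = i - 1"
  have ij: "i = Suc j" using i by (simp add: j_def)
  define C where "C = mmul (d 0) (seg d W 0 j) X"
  define A where "A = seg d W i (L - i)"
  have split: "mmul (d 0) (prodW d V L) X p q = mmul (d i) A (mmul (d j) (V i) C) p q"
    if V: "\<And>k. k \<noteq> i \<Longrightarrow> V k = W k" for V
  proof -
    have 1: "seg d V i (L - i) = A" "seg d V 0 j = seg d W 0 j"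
      unfolding A_def by (auto intro!: seg_cong V simp: ij)
    have 2: "seg d V 0 i = mmul (d j) (V i) (seg d W 0 j)"
      by (simp add: ij seg_Suc 1(2))
    have "prodW d V L p l = mmul (d i) A (mmul (d j) (V i) (seg d W 0 j)) p l" for l
      using seg_append[of p d 0 i "L - i" V l] i p 1 2 by (simp add: prodW_eq_seg)
    then have "mmul (d 0) (prodW d V L) X p q = mmul (d 0) (mmul (d i) A (mmul (d j) (V i) (seg d W 0 j))) X p q"
      by (intro mmul_cong) auto
    then show ?thesis by (simp add: mmul_assoc C_def)
  qed
  define V where "V = W(i := (W i)(a := (W i a)(b := s)))"
  define E where "E = (\<lambda>a' b'. if a' = a \<and> b' = b then s - W i a b else 0)"
  have Vi: "V i = (\<lambda>a' b'. W i a' b' + E a' b')"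
    by (auto simp: V_def E_def fun_eq_iff)
  have EC: "mmul (d j) E C a' q = (if a' = a then (s - W i a b) * C b q else 0)" for a'
    using ab(2) by (auto simp: mmul_def E_def ij if_distrib[of "\<lambda>x. x * _"] cong: if_cong)
  have AEC: "mmul (d i) A (mmul (d j) E C) p q = (s - W i a b) * (A p a * C b q)"
    using ab(1) unfolding mmul_def[of "d i"] EC by (simp add: if_distrib[of "\<lambda>x. _ * x"] cong: if_cong)
  have "mmul (d 0) (prodW d V L) X p q = mmul (d i) A (mmul (d j) (V i) C) p q"
    by (rule split) (simp add: V_def)
  also have "mmul (d j) (V i) C = (\<lambda>a' b'. mmul (d j) (W i) C a' b' + mmul (d j) E C a' b')"
    unfolding Vi by (simp add: mmul_add_left fun_eq_iff)
  also have "mmul (d i) A \<dots> p q = mmul (d i) A (mmul (d j) (W i) C) p q + (s - W i a b) * (A p a * C b q)"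
    by (simp add: mmul_add_right AEC)
  also have "mmul (d i) A (mmul (d j) (W i) C) p q = mmul (d 0) (prodW d W L) X p q"
    by (rule split[symmetric]) simp
  finally show ?thesis unfolding V_def A_def C_def j_def .
qed

text \<open>By the affine dependence the loss is a quadratic polynomial in the entry. The explicit
  formula replaces \<open>deriv\<close>, a choice operator, both for norm bounds and for
  measurability.\<close>

lemma grad_eq:
  assumes "1 \<le> i" "i \<le> L" "a < d i" "b < d (i - 1)"
  shows "grad \<alpha> d L n X Y W i a b = (\<Sum>p<d L. \<Sum>q<n. residual \<alpha> d L X Y W p q
    * (\<alpha> * (seg d W i (L - i) p a * mmul (d 0) (seg d W 0 (i - 1)) X b q)))"
proof -
  define F where "F = mmul (d 0) (prodW d W L) X"
  define G where "G = (\<lambda>p q. seg d W i (L - i) p a * mmul (d 0) (seg d W 0 (i - 1)) X b q)"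
  define w where "w = W i a b"
  have eq: "loss \<alpha> d L n X Y (W(i := (W i)(a := (W i a)(b := s))))
      = 1 / 2 * (\<Sum>p<d L. \<Sum>q<n. (\<alpha> * (F p q + (s - w) * G p q) - Y p q)\<^sup>2)" for s
    unfolding loss_eq_residual fro_power2 residual_def F_def G_def w_def
    using mmul_prodW_update_entry[where W = W and s = s and X = X, OF assms]
    by (intro arg_cong[of _ _ "\<lambda>x. 1 / 2 * x"] sum.cong refl) simp
  have "((\<lambda>s. 1 / 2 * (\<Sum>p<d L. \<Sum>q<n. (\<alpha> * (F p q + (s - w) * G p q) - Y p q)\<^sup>2))
      has_real_derivative 1 / 2 * (\<Sum>p<d L. \<Sum>q<n. 2 * ((\<alpha> * F p q - Y p q) * (\<alpha> * G p q)))) (at w)"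
    by (intro DERIV_cmult DERIV_sum) (auto intro!: derivative_eq_intros)
  then show ?thesis
    unfolding grad_def eq w_def[symmetric]
    by (subst DERIV_imp_deriv, assumption) (simp add: F_def G_def residual_def flip: sum_distrib_left)
qed

lemma fro_column_le: "a < m \<Longrightarrow> fro p 1 (\<lambda>p _. A p a) \<le> fro p m A"
  unfolding fro_def by (auto intro!: sum_mono member_le_sum[of a "{..<m}"])

lemma fro_row_le:
  assumes "b < m" shows "fro 1 q (\<lambda>_ q. A b q) \<le> fro m q A"
  unfolding fro_def using assms member_le_sum[of b "{..<m}" "\<lambda>b. \<Sum>q<q. (A b q)\<^sup>2"]
  by (simp add: sum_nonneg)

lemma abs_sum_mult_le_fro: "\<bar>\<Sum>p<m. \<Sum>q<n. A p q * B p q\<bar> \<le> fro m n A * fro m n B"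
proof -
  have "\<bar>\<Sum>p<m. \<Sum>q<n. A p q * B p q\<bar> = \<bar>\<Sum>x\<in>{..<m} \<times> {..<n}. (\<lambda>(p, q). A p q) x * (\<lambda>(p, q). B p q) x\<bar>"
    by (simp add: sum.cartesian_product case_prod_unfold)
  also have "\<dots> \<le> (\<Sum>x\<in>{..<m} \<times> {..<n}. \<bar>(\<lambda>(p, q). A p q) x\<bar> * \<bar>(\<lambda>(p, q). B p q) x\<bar>)"
    by (intro order_trans[OF sum_abs]) (simp add: abs_mult)
  also have "\<dots> \<le> fro m n A * fro m n B"
    unfolding fro_eq_L2_set by (rule L2_set_mult_ineq)
  finally show ?thesis .
qed

lemma abs_grad_le:
  assumes i: "1 \<le> i" "i \<le> L" and ab: "a < d i" "b < d (i - 1)" and \<alpha>: "0 \<le> \<alpha>"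
  shows "\<bar>grad \<alpha> d L n X Y W i a b\<bar> \<le> fro (d L) n (residual \<alpha> d L X Y W) *
    (\<alpha> * (fro (d L) (d i) (seg d W i (L - i)) * (fro (d (i - 1)) (d 0) (seg d W 0 (i - 1)) * fro (d 0) n X)))"
proof -
  let ?A = "seg d W i (L - i)" and ?C = "mmul (d 0) (seg d W 0 (i - 1)) X"
  have C: "fro (d (i - 1)) n ?C \<le> fro (d (i - 1)) (d 0) (seg d W 0 (i - 1)) * fro (d 0) n X"
    by (rule fro_mmul_le)
  \<comment> \<open>The outer product is a matrix product with inner dimension 1, so
    submultiplicativity of the norm applies to it.\<close>
  have "fro (d L) n (\<lambda>p q. \<alpha> * (?A p a * ?C b q)) = \<alpha> * fro (d L) n (mmul 1 (\<lambda>p _. ?A p a) (\<lambda>_ q. ?C b q))"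
    using \<alpha> by (simp add: fro_scale mmul_def)
  also have "\<dots> \<le> \<alpha> * (fro (d L) (d i) ?A * (fro (d (i - 1)) (d 0) (seg d W 0 (i - 1)) * fro (d 0) n X))"
    using ab \<alpha> by (intro mult_left_mono order_trans[OF fro_mmul_le] mult_mono fro_column_le
        order_trans[OF fro_row_le C]) (auto simp: fro_nonneg)
  finally have "fro (d L) n (\<lambda>p q. \<alpha> * (?A p a * ?C b q))
    \<le> \<alpha> * (fro (d L) (d i) ?A * (fro (d (i - 1)) (d 0) (seg d W 0 (i - 1)) * fro (d 0) n X))" .
  then show ?thesis
    unfolding grad_eq[OF i ab]
    by (intro order_trans[OF abs_sum_mult_le_fro] mult_left_mono fro_nonneg)
qed

text \<open>A bootstrap: while all entries are within \<open>\<tau> * \<eta> * g\<close> of their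
  initial values, segment norms at most double, so every partial derivative is at most
  \<open>g\<close> and a step moves each entry by at most \<open>\<eta> * g\<close>. Hence
  \<open>t\<close> steps move it by at most \<open>t * \<eta> * g\<close>, and the assumption
  persists up to time \<open>\<tau>\<close>. In \<open>g\<close> the first factor bounds the
  residual and the second one the slope of the output in an entry.\<close>

lemma gradient_descent_stays_small:
  fixes B D K R g \<delta> \<epsilon> \<eta> \<alpha> \<tau> :: real
  assumes fro_W: "\<And>i m. i + m \<le> L \<Longrightarrow> fro (d (i + m)) (d i) (seg d W0 i m) \<le> B * segprod \<rho> i m"
    and \<rho>: "\<And>k. 1 \<le> k \<Longrightarrow> k \<le> L \<Longrightarrow> 0 < \<rho> k"
    and R: "\<And>k. 1 \<le> k \<Longrightarrow> k \<le> L \<Longrightarrow> 1 \<le> R * \<rho> k"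
    and \<epsilon>: "\<alpha> * segprod \<rho> 0 L \<le> \<epsilon>"
    and D: "\<And>k. k \<le> L \<Longrightarrow> real (d k) \<le> D"
    and X: "fro (d 0) n X \<le> K" and Y: "fro (d L) n Y \<le> K"
    and pos: "0 \<le> \<alpha>" "0 \<le> \<eta>" "0 \<le> B" "0 \<le> R" "0 \<le> \<tau>"
    and g: "g = (2 * B * \<epsilon> * K + K) * (4 * B\<^sup>2 * (\<epsilon> * R) * K)"
    and \<delta>: "\<tau> * \<eta> * g * D * R \<le> \<delta>" and small: "real L * (2 * B * \<delta>) \<le> 1"
    and t: "real t \<le> \<tau>"
  defines "Wt \<equiv> gd \<alpha> d L n X Y \<eta> W0"
  shows "fro (d L) n (\<lambda>p q. \<alpha> * mmul (d 0) (prodW d (Wt t) L) X p q) \<le> 2 * B * \<epsilon> * K"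
proof -
  have S: "0 < segprod \<rho> i m" if "i + m \<le> L" for i m
    using that by (intro segprod_pos \<rho>) auto
  have \<epsilon>0: "0 \<le> \<epsilon>" using \<epsilon> S[of 0 L] pos(1) by (intro order_trans[OF _ \<epsilon>]) auto
  have K0: "0 \<le> K" using X fro_nonneg order_trans by blast
  have D0: "0 \<le> D" using D[of 0] by linarith
  have g0: "0 \<le> g" unfolding g using pos \<epsilon>0 K0 by simp
  have \<delta>0: "0 \<le> \<delta>" using pos g0 D0 by (intro order_trans[OF _ \<delta>]) auto
  \<comment> \<open>Stated for arbitrary weights \<open>V\<close> near \<open>W0\<close>, so that it
    is available before anything is known about the iterates.\<close>
  have seg_le: "fro (d (i + m)) (d i) (seg d V i m) \<le> 2 * B * segprod \<rho> i m"
    if dev: "\<And>k a b. \<bar>V k a b - W0 k a b\<bar> \<le> \<tau> * \<eta> * g" and im: "i + m \<le> L" for V i m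
  proof (rule fro_seg_perturbed_le[OF fro_W _ \<rho> pos(3) \<delta>0 small im])
    fix k assume k: "1 \<le> k" "k \<le> L"
    have "fro (d k) (d (k - 1)) (\<lambda>a b. V k a b - W0 k a b) \<le> D * (\<tau> * \<eta> * g)"
      using k pos g0 by (intro fro_le_entry_bound dev D) auto
    \<comment> \<open>Inserting \<open>R * \<rho> k\<close>, which is at least 1, converts the
      absolute deviation into one relative to the size of the layer.\<close>
    also have "\<dots> \<le> D * (\<tau> * \<eta> * g) * (R * \<rho> k)"
      using R[OF k] pos g0 D0 mult_left_mono[of 1 "R * \<rho> k" "D * (\<tau> * \<eta> * g)"] by simp
    also have "\<dots> = (\<tau> * \<eta> * g * D * R) * \<rho> k" by (simp add: mult_ac)
    also have "\<dots> \<le> \<delta> * \<rho> k" using \<delta> \<rho>[OF k] by (intro mult_right_mono) auto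
    finally show "fro (d k) (d (k - 1)) (\<lambda>a b. V k a b - W0 k a b) \<le> \<delta> * \<rho> k" .
  qed auto
  have out_le: "fro (d L) n (\<lambda>p q. \<alpha> * mmul (d 0) (prodW d V L) X p q) \<le> 2 * B * \<epsilon> * K"
    if dev: "\<And>k a b. \<bar>V k a b - W0 k a b\<bar> \<le> \<tau> * \<eta> * g" for V
  proof -
    have "fro (d L) n (\<lambda>p q. \<alpha> * mmul (d 0) (prodW d V L) X p q) = \<alpha> * fro (d L) n (mmul (d 0) (seg d V 0 L) X)"
      using pos(1) by (simp add: fro_scale prodW_eq_seg)
    also have "\<dots> \<le> \<alpha> * ((2 * B * segprod \<rho> 0 L) * K)"
      using seg_le[OF dev, of 0 L] X pos S[of 0 L]
      by (intro mult_left_mono order_trans[OF fro_mmul_le] mult_mono) (auto simp: fro_nonneg)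
    also have "\<dots> = (\<alpha> * segprod \<rho> 0 L) * (2 * B * K)" by simp
    also have "\<dots> \<le> \<epsilon> * (2 * B * K)" using \<epsilon> pos K0 by (intro mult_right_mono) auto
    finally show ?thesis by (simp add: mult_ac)
  qed
  have grad_le: "\<bar>grad \<alpha> d L n X Y V i a b\<bar> \<le> g"
    if dev: "\<And>k a b. \<bar>V k a b - W0 k a b\<bar> \<le> \<tau> * \<eta> * g"
      and i: "1 \<le> i" "i \<le> L" and ab: "a < d i" "b < d (i - 1)" for V i a b
  proof -
    let ?S = "segprod \<rho> i (L - i)" and ?S' = "segprod \<rho> 0 (i - 1)"
    have SS: "0 < ?S" "0 < ?S'" using i by (auto intro: S)
    have "segprod \<rho> 0 L = segprod \<rho> 0 (i - 1 + (1 + (L - i)))" using i by simp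
    also have "\<dots> = ?S' * (\<rho> i * ?S)"
      using i by (simp only: segprod_append) (simp add: segprod_def)
    finally have prod: "segprod \<rho> 0 L = ?S' * (\<rho> i * ?S)" .
    \<comment> \<open>The differentiated layer is missing from the product;
      \<open>R * \<rho> i\<close> puts it back, so the gradient inherits the smallness
      \<open>\<epsilon>\<close> of the full product.\<close>
    have "\<alpha> * (?S' * ?S) \<le> \<alpha> * (?S' * ?S) * (R * \<rho> i)"
      using mult_left_mono[OF R[OF i], of "\<alpha> * (?S' * ?S)"] SS pos(1) by simp
    also have "\<dots> = (\<alpha> * segprod \<rho> 0 L) * R" unfolding prod by simp
    also have "\<dots> \<le> \<epsilon> * R" using \<epsilon> pos by (intro mult_right_mono) auto
    finally have cut: "\<alpha> * (?S' * ?S) \<le> \<epsilon> * R" .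
    have res: "fro (d L) n (residual \<alpha> d L X Y V) \<le> 2 * B * \<epsilon> * K + K"
      unfolding residual_def
      by (intro order_trans[OF fro_diff_le] add_mono out_le[OF dev] Y)
    have A: "fro (d L) (d i) (seg d V i (L - i)) \<le> 2 * B * ?S"
      using seg_le[OF dev, of i "L - i"] i by simp
    have C: "fro (d (i - 1)) (d 0) (seg d V 0 (i - 1)) \<le> 2 * B * ?S'"
      using seg_le[OF dev, of 0 "i - 1"] i by simp
    have "\<alpha> * (fro (d L) (d i) (seg d V i (L - i)) * (fro (d (i - 1)) (d 0) (seg d V 0 (i - 1)) * fro (d 0) n X))
        \<le> \<alpha> * ((2 * B * ?S) * ((2 * B * ?S') * K))"
      using pos SS by (intro mult_left_mono mult_mono A C X) (auto simp: fro_nonneg)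
    also have "\<dots> = (\<alpha> * (?S' * ?S)) * (4 * B\<^sup>2 * K)" by (simp add: power2_eq_square)
    also have "\<dots> \<le> (\<epsilon> * R) * (4 * B\<^sup>2 * K)" using cut K0 by (intro mult_right_mono) auto
    finally have fac: "\<alpha> * (fro (d L) (d i) (seg d V i (L - i)) * (fro (d (i - 1)) (d 0) (seg d V 0 (i - 1)) * fro (d 0) n X))
        \<le> (\<epsilon> * R) * (4 * B\<^sup>2 * K)" .
    have "\<bar>grad \<alpha> d L n X Y V i a b\<bar> \<le> (2 * B * \<epsilon> * K + K) * ((\<epsilon> * R) * (4 * B\<^sup>2 * K))"
      by (rule order_trans[OF abs_grad_le[OF i ab pos(1)]], rule mult_mono[OF res fac])
        (use pos \<epsilon>0 K0 in \<open>auto simp: fro_nonneg\<close>)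
    then show ?thesis by (simp add: g mult_ac)
  qed
  have dev: "\<bar>Wt t k a b - W0 k a b\<bar> \<le> real t * \<eta> * g" if "real t \<le> \<tau>" for t k a b
    using that
  proof (induction t arbitrary: k a b)
    case 0
    then show ?case by (simp add: Wt_def)
  next
    case (Suc t)
    have le: "real t * \<eta> * g \<le> \<tau> * \<eta> * g"
      using Suc.prems pos g0 by (intro mult_right_mono) auto
    have IH: "\<bar>Wt t k a b - W0 k a b\<bar> \<le> real t * \<eta> * g" for k a b
      using Suc.IH Suc.prems by simp
    show ?case
    proof (cases "1 \<le> k \<and> k \<le> L \<and> a < d k \<and> b < d (k - 1)")
      case True
      have "\<bar>\<eta> * grad \<alpha> d L n X Y (Wt t) k a b\<bar> \<le> \<eta> * g"
        unfolding abs_mult using True pos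
        by (intro mult_mono grad_le order_trans[OF IH le]) auto
      moreover have "Wt (Suc t) k a b = Wt t k a b - \<eta> * grad \<alpha> d L n X Y (Wt t) k a b"
        using True by (simp add: Wt_def)
      ultimately show ?thesis using IH[of k a b] by (simp add: algebra_simps abs_le_iff)
    next
      case False
      then have "Wt (Suc t) k a b = Wt t k a b" by (auto simp: Wt_def)
      moreover have "real t * \<eta> * g \<le> real (Suc t) * \<eta> * g"
        using pos g0 by (intro mult_right_mono) auto
      ultimately show ?thesis using IH[of k a b] by simp
    qed
  qed
  show ?thesis
  proof (rule out_le)
    fix k a b
    have "real t * \<eta> * g \<le> \<tau> * \<eta> * g" using t pos g0 by (intro mult_right_mono) auto
    then show "\<bar>Wt t k a b - W0 k a b\<bar> \<le> \<tau> * \<eta> * g" using dev[OF t] order_trans by blast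
  qed
qed

text \<open>The tolerance 1/20 places half of the squared residual between 361/800 and 441/800 of
  the squared norm of \<open>Y\<close>, inside the interval from 0.4 to 0.6.\<close>

lemma loss_bounds_of_small_output:
  assumes "fro (d L) n (\<lambda>p q. \<alpha> * mmul (d 0) (prodW d W L) X p q) \<le> fro (d L) n Y / 20"
  shows "0.4 * (fro (d L) n Y)\<^sup>2 \<le> loss \<alpha> d L n X Y W" "loss \<alpha> d L n X Y W \<le> 0.6 * (fro (d L) n Y)\<^sup>2"
proof -
  define y where "y = fro (d L) n Y"
  define r where "r = fro (d L) n (residual \<alpha> d L X Y W)"
  have y: "0 \<le> y" by (simp add: y_def fro_nonneg)
  have r: "19 / 20 * y \<le> r" "r \<le> 21 / 20 * y"
    using fro_diff_ge[of "d L" n Y "\<lambda>p q. \<alpha> * mmul (d 0) (prodW d W L) X p q"]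
      fro_diff_le[of "d L" n "\<lambda>p q. \<alpha> * mmul (d 0) (prodW d W L) X p q" Y] assms
    by (simp_all add: y_def r_def residual_def)
  have "(19 / 20 * y)\<^sup>2 \<le> r\<^sup>2" using r y by (intro power_mono) auto
  moreover have "r\<^sup>2 \<le> (21 / 20 * y)\<^sup>2" using r y by (intro power_mono) auto
  moreover have "(19 / 20 * y)\<^sup>2 = 361 / 400 * y\<^sup>2" "(21 / 20 * y)\<^sup>2 = 441 / 400 * y\<^sup>2"
    by (simp_all add: power2_eq_square)
  ultimately have "0.4 * y\<^sup>2 \<le> 1 / 2 * r\<^sup>2" "1 / 2 * r\<^sup>2 \<le> 0.6 * y\<^sup>2"
    using zero_le_power2[of y] by linarith+
  then show "0.4 * (fro (d L) n Y)\<^sup>2 \<le> loss \<alpha> d L n X Y W"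
    "loss \<alpha> d L n X Y W \<le> 0.6 * (fro (d L) n Y)\<^sup>2"
    by (simp_all add: loss_eq_residual y_def r_def)
qed

section \<open>Measurability of the loss along the trajectory\<close>

lemma loss_measurable:
  assumes "\<And>i a b. (\<lambda>\<omega>. W \<omega> i a b) \<in> borel_measurable M"
  shows "(\<lambda>\<omega>. loss \<alpha> d L n X Y (W \<omega>)) \<in> borel_measurable M"
proof -
  have [measurable]: "(\<lambda>\<omega>. prodW d (W \<omega>) L a b) \<in> borel_measurable M" for a b
    unfolding prodW_eq_seg by (rule seg_measurable[OF assms])
  show ?thesis
    unfolding loss_eq_residual fro_power2 residual_def mmul_def by measurable
qed

lemma gd_measurable:
  assumes "\<And>i a b. (\<lambda>\<omega>. W \<omega> i a b) \<in> borel_measurable M"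
  shows "(\<lambda>\<omega>. gd \<alpha> d L n X Y \<eta> (W \<omega>) t i a b) \<in> borel_measurable M"
proof (induction t arbitrary: i a b)
  case 0
  then show ?case by (simp add: assms)
next
  case (Suc t)
  note [measurable] = Suc
  have [measurable]: "(\<lambda>\<omega>. seg d (gd \<alpha> d L n X Y \<eta> (W \<omega>) t) i m a b) \<in> borel_measurable M" for i m a b
    by (rule seg_measurable[OF Suc])
  show ?case
  proof (cases "1 \<le> i \<and> i \<le> L \<and> a < d i \<and> b < d (i - 1)")
    case True
    then have "(\<lambda>\<omega>. gd \<alpha> d L n X Y \<eta> (W \<omega>) (Suc t) i a b) = (\<lambda>\<omega>. gd \<alpha> d L n X Y \<eta> (W \<omega>) t i a b
        - \<eta> * (\<Sum>p<d L. \<Sum>q<n. residual \<alpha> d L X Y (gd \<alpha> d L n X Y \<eta> (W \<omega>) t) p q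
        * (\<alpha> * (seg d (gd \<alpha> d L n X Y \<eta> (W \<omega>) t) i (L - i) p a
          * mmul (d 0) (seg d (gd \<alpha> d L n X Y \<eta> (W \<omega>) t) 0 (i - 1)) X b q))))"
      by (simp add: grad_eq)
    then show ?thesis
      unfolding residual_def mmul_def prodW_eq_seg by simp
  next
    case False
    then have "(\<lambda>\<omega>. gd \<alpha> d L n X Y \<eta> (W \<omega>) (Suc t) i a b) = (\<lambda>\<omega>. gd \<alpha> d L n X Y \<eta> (W \<omega>) t i a b)"
      by (auto simp: fun_eq_iff)
    then show ?thesis by simp
  qed
qed

section \<open>Asymptotics and the budget of constants\<close>

lemma eventually_exp_beats_powers:
  fixes C K \<gamma> :: real
  assumes "0 < \<gamma>" "1 \<le> K"
  shows "\<forall>\<^sub>F L :: nat in sequentially.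
    C * real L ^ 11 * (real L powr (K / 2)) ^ 3 * exp (- (real L powr \<gamma>) / (50 * K)) \<le> 1"
proof -
  have "0 < K" using assms by simp
  then have "((\<lambda>x::real. C * x ^ 11 * (x powr (K / 2)) ^ 3 * exp (- (x powr \<gamma>) / (50 * K))) \<longlongrightarrow> 0) at_top"
    using assms(1) by real_asymp
  then have "\<forall>\<^sub>F x in at_top. C * x ^ 11 * (x powr (K / 2)) ^ 3 * exp (- (x powr \<gamma>) / (50 * K)) < 1"
    by (rule order_tendstoD) simp
  then have "\<forall>\<^sub>F L :: nat in sequentially.
    C * real L ^ 11 * (real L powr (K / 2)) ^ 3 * exp (- (real L powr \<gamma>) / (50 * K)) < 1"
    by (rule eventually_compose_filterlim[OF _ filterlim_real_sequentially])
  then show ?thesis by (rule eventually_mono) simp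
qed

text \<open>Here \<open>l\<close> stands for the depth, \<open>h\<close> for
  \<open>l powr (K / 2)\<close>, \<open>u\<close> for the exponentially small factor and
  \<open>1 / u\<close> for the bound on steps times learning rate. The right-hand side
  \<open>1 / (2 * l * B)\<close> is the largest relative deviation that the perturbation bound
  tolerates. Multiplying out the second claim gives
  \<open>4096000 * K^6 * l^11 * h^3 * u \<le> 1\<close>; this is the origin of the exponents and,
  rounded up, of the constant in the hypothesis.\<close>

lemma parameter_bounds:
  fixes K l h u :: real
  assumes K: "1 \<le> K" and l: "1 \<le> l" and h: "1 \<le> h" and u: "0 < u" "u \<le> 1"
    and H: "5000000 * K ^ 6 * l ^ 11 * h ^ 3 * u \<le> 1"
  defines "B \<equiv> 40 * K * l ^ 3" and "\<epsilon> \<equiv> h * u\<^sup>2" and "R \<equiv> 2 * h"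
  shows "2 * B * \<epsilon> * K \<le> 1 / (20 * K)"
    and "1 / u * ((2 * B * \<epsilon> * K + K) * (4 * B\<^sup>2 * (\<epsilon> * R) * K)) * (K * l) * R \<le> 1 / (2 * l * B)"
proof -
  have "1600 * (K ^ 3 * l ^ 3 * h ^ 1 * u\<^sup>2) \<le> 5000000 * (K ^ 6 * l ^ 11 * h ^ 3 * u)"
  proof (intro mult_mono)
    show "u\<^sup>2 \<le> u" using u by (simp add: power2_eq_square mult_left_le)
  qed (use K l h u in \<open>auto intro!: power_increasing intro: self_le_power\<close>)
  also have "\<dots> \<le> 1" using H by (simp only: mult.assoc)
  finally have "1600 * (K ^ 3 * l ^ 3 * h * u\<^sup>2) \<le> 1" by (simp only: power_one_right)
  moreover have "2 * B * \<epsilon> * K * (20 * K) = 1600 * (K ^ 3 * l ^ 3 * h * u\<^sup>2)"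
    by (simp add: B_def \<epsilon>_def power2_eq_square power3_eq_cube)
  ultimately have 1: "2 * B * \<epsilon> * K * (20 * K) \<le> 1" by (simp only:)
  then show 2: "2 * B * \<epsilon> * K \<le> 1 / (20 * K)"
    using K by (simp add: field_simps)
  have pos: "0 \<le> B" "0 \<le> \<epsilon>" "0 \<le> R" using K l h by (simp_all add: B_def \<epsilon>_def R_def)
  have "1 / (20 * K) \<le> K" using K mult_mono[of 1 K 1 K] by (simp add: field_simps)
  then have 3: "2 * B * \<epsilon> * K + K \<le> 2 * K" using 2 by simp
  have "1 / u * ((2 * B * \<epsilon> * K + K) * (4 * B\<^sup>2 * (\<epsilon> * R) * K)) * (K * l) * R
      \<le> 1 / u * ((2 * K) * (4 * B\<^sup>2 * (\<epsilon> * R) * K)) * (K * l) * R"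
    using pos K l u by (intro mult_right_mono mult_left_mono 3) auto
  also have "\<dots> = 51200 * K ^ 5 * l ^ 7 * h ^ 3 * u"
    using u by (simp add: B_def \<epsilon>_def R_def field_simps power2_eq_square) (simp add: power_numeral_reduce)
  also have "\<dots> \<le> 1 / (2 * l * B)"
  proof -
    have "51200 * K ^ 5 * l ^ 7 * h ^ 3 * u * (2 * l * B) = 4096000 * (K ^ 6 * l ^ 11 * h ^ 3 * u)"
      by (simp add: B_def power_numeral_reduce)
    also have "\<dots> \<le> 5000000 * (K ^ 6 * l ^ 11 * h ^ 3 * u)"
      using K l h u by (intro mult_right_mono) auto
    also have "\<dots> \<le> 1" using H by simp
    finally show ?thesis using K l by (simp add: B_def pos_le_divide_eq)
  qed
  finally show "1 / u * ((2 * B * \<epsilon> * K + K) * (4 * B\<^sup>2 * (\<epsilon> * R) * K)) * (K * l) * R \<le> 1 / (2 * l * B)" .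
qed

text \<open>The root of the normalization hypothesis gives the power of \<open>L\<close>. The loss
  factors are handled by \<open>1 - x \<le> exp (- x)\<close> with every width replaced by its upper
  bound, where \<open>L / (25 * K * L powr (1 - \<gamma>))\<close> is
  \<open>L powr \<gamma> / (25 * K)\<close>.\<close>

lemma scaled_segprod_le:
  fixes \<alpha> K \<gamma> :: real
  assumes \<sigma>: "\<And>i. 0 < \<sigma> i" and \<alpha>: "0 < \<alpha>" and K: "1 \<le> K" and L: "1 \<le> L"
    and d: "\<And>i. i \<le> L \<Longrightarrow> 0 < d i \<and> real (d i) \<le> K * real L powr (1 - \<gamma>)"
    and prod: "\<alpha>\<^sup>2 * (\<Prod>i\<in>{1..L}. real (d i) * (\<sigma> i)\<^sup>2) \<le> real L powr K"
  shows "\<alpha> * segprod (\<lambda>k. sqrt (real (d k)) * \<sigma> k * (1 - 1 / (25 * real (d k)))) 0 L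
    \<le> real L powr (K / 2) * (exp (- (real L powr \<gamma>) / (50 * K)))\<^sup>2"
proof -
  let ?s = "\<lambda>k. sqrt (real (d k)) * \<sigma> k" and ?r = "\<lambda>k. 1 - 1 / (25 * real (d k))"
  let ?D = "K * real L powr (1 - \<gamma>)"
  have D: "0 < ?D" using K L by simp
  have "\<alpha> * (\<Prod>i\<in>{1..L}. ?s i) \<le> sqrt (real L powr K)"
    using prod by (intro real_le_rsqrt) (simp add: power_mult_distrib prod_power_distrib)
  also have "\<dots> = real L powr (K / 2)" by (simp add: powr_half_sqrt[symmetric] powr_powr)
  finally have 1: "\<alpha> * (\<Prod>i\<in>{1..L}. ?s i) \<le> real L powr (K / 2)" .
  have r0: "0 \<le> ?r i" if "i \<le> L" for i using d[OF that] by (simp add: field_simps)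
  have "(\<Prod>i\<in>{1..L}. ?r i) \<le> (\<Prod>i\<in>{1..L}. exp (- 1 / (25 * ?D)))"
  proof (rule prod_mono, intro conjI)
    fix i assume "i \<in> {1..L}"
    then have i: "i \<le> L" by simp
    show "0 \<le> ?r i" by (rule r0[OF i])
    have "?r i \<le> exp (- 1 / (25 * real (d i)))"
      using exp_ge_add_one_self[of "- 1 / (25 * real (d i))"] by simp
    also have "\<dots> \<le> exp (- 1 / (25 * ?D))"
      using d[OF i] D by (simp add: frac_le)
    finally show "?r i \<le> exp (- 1 / (25 * ?D))" .
  qed
  also have "\<dots> = exp (- (real L / (25 * ?D)))"
    by (simp flip: exp_of_nat_mult)
  also have "real L / (25 * ?D) = real L powr \<gamma> / (25 * K)"
    using L K by (simp add: powr_diff field_simps)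
  also have "exp (- (real L powr \<gamma> / (25 * K))) = (exp (- (real L powr \<gamma>) / (50 * K)))\<^sup>2"
    by (simp flip: exp_of_nat_mult exp_double)
  finally have 2: "(\<Prod>i\<in>{1..L}. ?r i) \<le> (exp (- (real L powr \<gamma>) / (50 * K)))\<^sup>2" .
  have "\<alpha> * segprod (\<lambda>k. ?s k * ?r k) 0 L = (\<alpha> * (\<Prod>i\<in>{1..L}. ?s i)) * (\<Prod>i\<in>{1..L}. ?r i)"
    by (simp add: segprod_eq_prod prod.distrib)
  also have "\<dots> \<le> real L powr (K / 2) * (exp (- (real L powr \<gamma>) / (50 * K)))\<^sup>2"
    using 1 2 r0 by (intro mult_mono prod_nonneg) auto
  finally show ?thesis .
qed

theorem theorem5p1:
  fixes \<gamma> K :: real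
  assumes "0 < \<gamma>" and "\<gamma> \<le> 1" and "K \<ge> 1"
  shows "\<exists>c c' :: real. \<exists>L0 :: nat. c > 0 \<and> c' > 0 \<and>
    (\<forall>(L::nat) (d::nat \<Rightarrow> nat) (n::nat) (X::mat) (Wstar::mat) (Y::mat)
       (\<sigma>::nat \<Rightarrow> real) (\<alpha>::real) (\<eta>::real).
       L \<ge> 1 \<and> L \<ge> L0 \<and>
       (\<forall>i\<le>L. 0 < d i \<and> real (d i) \<le> K * real L powr (1 - \<gamma>)) \<and>
       Y = mmul (d 0) Wstar X \<and>
       1 / K \<le> fro (d 0) n X \<and> fro (d 0) n X \<le> K \<and>
       1 / K \<le> fro (d L) n Y \<and> fro (d L) n Y \<le> K \<and>
       (\<forall>i\<in>{1..L}. \<sigma> i > 0) \<and> \<alpha> > 0 \<and>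
       \<alpha>\<^sup>2 * (\<Prod>i\<in>{1..L}. real (d i) * (\<sigma> i)\<^sup>2) \<le> real L powr K \<and>
       (\<forall>i\<in>{1..L}. real (d i) * (\<sigma> i)\<^sup>2 \<ge> real L powr (- K)) \<and>
       0 < \<eta> \<and> \<eta> \<le> exp (c * real L powr \<gamma>)
       \<longrightarrow>
       measure (init_measure d L \<sigma>)
         {\<omega> \<in> space (init_measure d L \<sigma>).
            \<forall>t::nat. real t \<le> exp (c' * real L powr \<gamma>) \<longrightarrow>
              0.4 * (fro (d L) n Y)\<^sup>2 \<le> loss \<alpha> d L n X Y (gd \<alpha> d L n X Y \<eta> (to_weights d L \<omega>) t) \<and>
              loss \<alpha> d L n X Y (gd \<alpha> d L n X Y \<eta> (to_weights d L \<omega>) t) \<le> 0.6 * (fro (d L) n Y)\<^sup>2}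
       \<ge> 0.9)"
proof -
  \<comment> \<open>One constant serves as both \<open>c\<close> and \<open>c'\<close>. Then
    \<open>exp (c * L powr \<gamma>)\<close> is the inverse square root of \<open>u\<close> below,
    and the number of steps times the learning rate is at most \<open>1 / u\<close>.\<close>
  define c where "c = 1 / (100 * K)"
  have c: "0 < c" using assms by (simp add: c_def)
  obtain L0 where L0: "\<And>L. L \<ge> L0 \<Longrightarrow> 5000000 * K ^ 6 * real L ^ 11 * (real L powr (K / 2)) ^ 3
      * exp (- (real L powr \<gamma>) / (50 * K)) \<le> 1"
    using eventually_exp_beats_powers[OF assms(1,3), of "5000000 * K ^ 6"]
    unfolding eventually_sequentially by blast
  show ?thesis
  proof (rule exI[of _ c], rule exI[of _ c], rule exI[of _ L0], intro conjI allI impI c, elim conjE)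
    fix L :: nat and d :: "nat \<Rightarrow> nat" and n :: nat and X Wstar Y :: mat
      and \<sigma> :: "nat \<Rightarrow> real" and \<alpha> \<eta> :: real
    assume L: "1 \<le> L" "L0 \<le> L"
      and d: "\<forall>i\<le>L. 0 < d i \<and> real (d i) \<le> K * real L powr (1 - \<gamma>)"
      and X: "fro (d 0) n X \<le> K" and Y: "1 / K \<le> fro (d L) n Y" "fro (d L) n Y \<le> K"
      and \<sigma>: "\<forall>i\<in>{1..L}. 0 < \<sigma> i" and \<alpha>: "0 < \<alpha>"
      and up: "\<alpha>\<^sup>2 * (\<Prod>i\<in>{1..L}. real (d i) * (\<sigma> i)\<^sup>2) \<le> real L powr K"
      and low: "\<forall>i\<in>{1..L}. real L powr (- K) \<le> real (d i) * (\<sigma> i)\<^sup>2"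
      and \<eta>: "0 < \<eta>" "\<eta> \<le> exp (c * real L powr \<gamma>)"
    \<comment> \<open>\<open>normal_density 0 0\<close> is the zero function, so \<open>\<sigma>\<close> is made positive also outside \<open>{1..L}\<close>
      in order that every factor is a probability measure.\<close>
    define \<sigma>' where "\<sigma>' = (\<lambda>i. if i \<in> {1..L} then \<sigma> i else 1)"
    have \<sigma>': "0 < \<sigma>' i" for i using \<sigma> by (simp add: \<sigma>'_def)
    have M_eq: "init_measure d L \<sigma> = init_measure d L \<sigma>'"
      unfolding init_measure_def by (intro PiM_cong) (auto simp: \<sigma>'_def widx_def)
    define M where "M = init_measure d L \<sigma>'"
    interpret prob_space M
      unfolding M_def init_measure_def by (intro prob_space_PiM prob_space_normal_density \<sigma>')
    define l where "l = real L"
    define h where "h = l powr (K / 2)"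
    define u where "u = exp (- (l powr \<gamma>) / (50 * K))"
    define \<tau> where "\<tau> = exp (c * l powr \<gamma>)"
    define \<rho> where "\<rho> = (\<lambda>k. sqrt (real (d k)) * \<sigma>' k * (1 - 1 / (25 * real (d k))))"
    have l: "1 \<le> l" using L by (simp add: l_def)
    have h: "1 \<le> h" using l assms(3) by (simp add: h_def ge_one_powr_ge_zero)
    have u: "0 < u" "u \<le> 1" using assms(3) by (simp_all add: u_def)
    \<comment> \<open>A cruder width bound suffices for the polynomial factors and keeps the powers
      of \<open>l\<close> integral; the sharp one matters only for the decay.\<close>
    have D: "real (d k) \<le> K * l" if "k \<le> L" for k
    proof -
      have "l powr (1 - \<gamma>) \<le> l powr 1" using l assms by (intro powr_mono) auto
      then have "K * l powr (1 - \<gamma>) \<le> K * l" using l assms(3) by simp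
      then show ?thesis using d that by (force simp: l_def)
    qed
    have H: "5000000 * K ^ 6 * l ^ 11 * h ^ 3 * u \<le> 1"
      using L0[OF L(2)] by (simp add: l_def h_def u_def)
    note bounds = parameter_bounds[OF assms(3) l h u H]
    \<comment> \<open>The factor \<open>2 * h\<close> arises because the lower bound on the
      variances gives \<open>sqrt (d k) * \<sigma>' k \<ge> 1 / h\<close>, and the loss factor of a
      layer is never below 1/2.\<close>
    have \<rho>: "0 < \<rho> k" and R: "1 \<le> 2 * h * \<rho> k" if k: "1 \<le> k" "k \<le> L" for k
    proof -
      have dk: "1 \<le> real (d k)" using d k by (simp add: Suc_le_eq)
      then have r: "1 / 2 \<le> 1 - 1 / (25 * real (d k))" by (simp add: field_simps)
      then show "0 < \<rho> k" using dk \<sigma>'[of k] by (auto simp: \<rho>_def intro!: mult_pos_pos)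
      have "1 / h = sqrt (l powr (- K))"
        using powr_minus_divide[of l "K / 2"] by (simp add: h_def powr_half_sqrt[symmetric] powr_powr)
      also have "\<dots> \<le> sqrt (real (d k) * (\<sigma>' k)\<^sup>2)"
        using low k by (simp add: l_def \<sigma>'_def)
      also have "\<dots> = sqrt (real (d k)) * \<sigma>' k"
        using \<sigma>'[of k] by (simp add: real_sqrt_mult)
      finally have "1 / h * (1 / 2) \<le> \<rho> k"
        unfolding \<rho>_def using r h less_imp_le[OF \<sigma>'[of k]] by (intro mult_mono) auto
      then show "1 \<le> 2 * h * \<rho> k" using h by (simp add: field_simps)
    qed
    have \<epsilon>: "\<alpha> * segprod \<rho> 0 L \<le> h * u\<^sup>2"
    proof -
      have "(\<Prod>i\<in>{1..L}. real (d i) * (\<sigma>' i)\<^sup>2) = (\<Prod>i\<in>{1..L}. real (d i) * (\<sigma> i)\<^sup>2)"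
        by (intro prod.cong) (auto simp: \<sigma>'_def)
      then show ?thesis
        unfolding \<rho>_def h_def u_def l_def
        using up d by (intro scaled_segprod_le[OF \<sigma>' \<alpha> assms(3) L(1)]) auto
    qed
    have \<tau>: "\<tau> * \<eta> \<le> 1 / u"
    proof -
      have "\<tau> * \<eta> \<le> \<tau> * \<tau>" using \<eta> by (simp add: \<tau>_def l_def)
      also have "\<dots> = 1 / u"
        by (simp add: \<tau>_def u_def c_def exp_minus inverse_eq_divide flip: exp_add)
      finally show ?thesis .
    qed
    \<comment> \<open>Since \<open>l + 1 \<le> 2 * l\<close>, this absorbs the Markov factor
      \<open>10 * (l + 1)^2 * (K * l)\<close>.\<close>
    define B where "B = 40 * K * l ^ 3"
    define g where "g = (2 * B * (h * u\<^sup>2) * K + K) * (4 * B\<^sup>2 * (h * u\<^sup>2 * (2 * h)) * K)"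
    have B: "0 < B" using assms(3) l by (simp add: B_def)
    have \<delta>: "\<tau> * \<eta> * g * (K * l) * (2 * h) \<le> 1 / (2 * l * B)"
    proof -
      have "\<tau> * \<eta> * g * (K * l) * (2 * h) \<le> 1 / u * g * (K * l) * (2 * h)"
        using \<tau> B h l assms(3) by (intro mult_right_mono) (auto simp: g_def)
      also have "\<dots> \<le> 1 / (2 * l * B)" using bounds(2) by (simp only: B_def g_def)
      finally show ?thesis .
    qed
    obtain G where G: "G \<in> sets M" "0.9 \<le> prob G"
      and fro_G: "\<And>\<omega> i m. \<omega> \<in> G \<Longrightarrow> i + m \<le> L \<Longrightarrow>
        fro (d (i + m)) (d i) (seg d (to_weights d L \<omega>) i m) \<le> 10 * (l + 1)\<^sup>2 * (K * l) * segprod \<rho> i m"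
      using prob_all_seg_bounded[of \<sigma>' L d "K * l", OF \<sigma>' _ D] d
      unfolding \<rho>_def M_def l_def by blast
    let ?A = "{\<omega> \<in> space M. \<forall>t::nat. real t \<le> exp (c * real L powr \<gamma>) \<longrightarrow>
              0.4 * (fro (d L) n Y)\<^sup>2 \<le> loss \<alpha> d L n X Y (gd \<alpha> d L n X Y \<eta> (to_weights d L \<omega>) t) \<and>
              loss \<alpha> d L n X Y (gd \<alpha> d L n X Y \<eta> (to_weights d L \<omega>) t) \<le> 0.6 * (fro (d L) n Y)\<^sup>2}"
    have "G \<subseteq> ?A"
    proof (intro subsetI CollectI conjI allI impI)
      fix \<omega> assume \<omega>: "\<omega> \<in> G"
      show "\<omega> \<in> space M" using \<omega> G(1) sets.sets_into_space by blast
      have "fro (d (i + m)) (d i) (seg d (to_weights d L \<omega>) i m) \<le> B * segprod \<rho> i m"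
        if "i + m \<le> L" for i m
      proof -
        have "(l + 1)\<^sup>2 \<le> (2 * l)\<^sup>2" using l by (intro power_mono) auto
        then have "10 * (l + 1)\<^sup>2 * (K * l) \<le> 10 * (2 * l)\<^sup>2 * (K * l)"
          using l assms(3) by (intro mult_right_mono) auto
        also have "\<dots> = B" by (simp add: B_def power2_eq_square power3_eq_cube)
        finally have "10 * (l + 1)\<^sup>2 * (K * l) * segprod \<rho> i m \<le> B * segprod \<rho> i m"
          using that by (intro mult_right_mono less_imp_le[OF segprod_pos] \<rho>) auto
        then show ?thesis using fro_G[OF \<omega> that] by linarith
      qed
      note stays = gradient_descent_stays_small[OF this \<rho> R \<epsilon> D X Y(2) _ _ _ _ _ g_def \<delta>]
      fix t :: nat assume t: "real t \<le> exp (c * real L powr \<gamma>)"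
      have "fro (d L) n (\<lambda>p q. \<alpha> * mmul (d 0) (prodW d (gd \<alpha> d L n X Y \<eta> (to_weights d L \<omega>) t) L) X p q)
          \<le> 2 * B * (h * u\<^sup>2) * K"
        by (rule stays) (use \<alpha> \<eta> B h l t L in \<open>auto simp: \<tau>_def l_def\<close>)
      also have "\<dots> \<le> 1 / (20 * K)" using bounds(1) by (simp only: B_def)
      also have "\<dots> \<le> fro (d L) n Y / 20" using Y(1) by simp
      finally have *: "fro (d L) n (\<lambda>p q. \<alpha> * mmul (d 0) (prodW d (gd \<alpha> d L n X Y \<eta> (to_weights d L \<omega>) t) L) X p q)
          \<le> fro (d L) n Y / 20" .
      show "0.4 * (fro (d L) n Y)\<^sup>2 \<le> loss \<alpha> d L n X Y (gd \<alpha> d L n X Y \<eta> (to_weights d L \<omega>) t)"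
        "loss \<alpha> d L n X Y (gd \<alpha> d L n X Y \<eta> (to_weights d L \<omega>) t) \<le> 0.6 * (fro (d L) n Y)\<^sup>2"
        by (rule loss_bounds_of_small_output[OF *])+
    qed
    \<comment> \<open>Monotonicity of the measure requires this: a non-measurable set would have
      measure 0 by convention.\<close>
    moreover have "?A \<in> sets M"
    proof -
      have [measurable]: "(\<lambda>\<omega>. loss \<alpha> d L n X Y (gd \<alpha> d L n X Y \<eta> (to_weights d L \<omega>) t)) \<in> borel_measurable M" for t
        unfolding M_def init_measure_def by (intro loss_measurable gd_measurable to_weights_measurable)
      show ?thesis by measurable
    qed
    ultimately have "prob G \<le> prob ?A" by (intro finite_measure_mono)
    then show "0.9 \<le> measure (init_measure d L \<sigma>) {\<omega> \<in> space (init_measure d L \<sigma>). \<forall>t::nat. real t \<le> exp (c * real L powr \<gamma>) \<longrightarrow>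
              0.4 * (fro (d L) n Y)\<^sup>2 \<le> loss \<alpha> d L n X Y (gd \<alpha> d L n X Y \<eta> (to_weights d L \<omega>) t) \<and>
              loss \<alpha> d L n X Y (gd \<alpha> d L n X Y \<eta> (to_weights d L \<omega>) t) \<le> 0.6 * (fro (d L) n Y)\<^sup>2}"
      using G(2) unfolding M_eq M_def by (rule order_trans[rotated])
  qed
qed

end
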